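(* Assume that $0<p_0<\infty$, $0<q_0<\infty$ and $0<\mu<n-2\lambda$. Let $(u,v)\in C^{1}(\partial\mathbb{R}_{+}^{n})\times C^{1}(\mathbb{R}_{+}^{n})$ be a pair of non-trivial non-negative solutions of the integral system $$\begin{cases}u(y)=\displaystyle\int_{\mathbb{R}^{n}_{+}}|x|^{-\beta}P_{\lambda}(x,y,\mu)v^{q_{0}}(x)\,dx, & y\in\partial\mathbb{R}^{n}_{+},\\[2mm] v(x)=\displaystyle\int_{\partial\mathbb{R}^{n}_{+}}|y|^{-\alpha}P_{\lambda}(x,y,\mu)u^{p_{0}}(y)\,dy, & x\in\mathbb{R}^{n}_{+},\end{cases}$$ with $$(u,v)\in L^{p_{0}+1}\left(|y|^{-\alpha}dy,\partial\mathbb{R}^{n}_{+}\right)\times L^{q_{0}+1}\left(|x|^{-\beta}dx,\mathbb{R}^{n}_{+}\right).$$ Then it must hold that $$\frac{n-1-\alpha}{p_{0}+1}+\frac{n-\beta}{q_{0}+1}=\mu-\lambda.$$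
   Context: $n\ge 3$, $\lambda\ge 0$, $\alpha,\beta\ge 0$. $\mathbb{R}^n_+=\{x=(x',x_n)\in\mathbb{R}^{n-1}\times\mathbb{R}: x_n>0\}$, with boundary $\partial\mathbb{R}^n_+$ identified with $\mathbb{R}^{n-1}$. The kernel is $$P_{\lambda}(x,y,\mu)=\frac{x_{n}^{\lambda}}{\left(|x'-y|^{2}+x_{n}^{2}\right)^{\mu/2}},\qquad x=(x',x_n)\in\mathbb{R}^n_+,\ y\in\partial\mathbb{R}^n_+.$$ $L^{s}(w\,dx,\Omega)$ denotes the weighted Lebesgue space of functions $h$ on $\Omega$ with $\int_\Omega |h|^s w\,dx<\infty$. *)

theory Defs
  imports "HOL-Analysis.Analysis"
begin

text \<open>
  Points of \<open>\<real>\<^sup>n = \<real>\<^sup>n\<^sup>-\<^sup>1 \<times> \<real>\<close> are pairs \<open>x = (x', x\<^sub>n)\<close> of type \<open>(real^'m) \<times> real\<close>, where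
  \<open>n = CARD('m) + 1\<close>; the product norm and Lebesgue measure are the Euclidean ones. The boundary
  of the half space is identified with the type \<open>real^'m\<close>.
\<close>

definition half_space :: "((real^'m) \<times> real) set" where
  "half_space = {x. snd x > 0}"

definition poisson_kernel ::
    "real \<Rightarrow> (real^'m) \<times> real \<Rightarrow> real^'m \<Rightarrow> real \<Rightarrow> real" where
  "poisson_kernel lam x y \<mu> =
     snd x powr lam / ((norm (fst x - y))\<^sup>2 + (snd x)\<^sup>2) powr (\<mu> / 2)"

text \<open>Intended for open \<open>S\<close>.\<close>

definition C1_on :: "'a::euclidean_space set \<Rightarrow> ('a \<Rightarrow> real) \<Rightarrow> bool" where
  "C1_on S f \<longleftrightarrow>
     (\<exists>f' :: 'a \<Rightarrow> 'a \<Rightarrow>\<^sub>L real.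
        (\<forall>x\<in>S. (f has_derivative blinfun_apply (f' x)) (at x)) \<and> continuous_on S f')"

definition weighted_Lp ::
    "real \<Rightarrow> ('a::euclidean_space \<Rightarrow> real) \<Rightarrow> 'a set \<Rightarrow> ('a \<Rightarrow> real) set" where
  "weighted_Lp s w S =
     {h. set_borel_measurable lebesgue S h \<and>
         (\<integral>\<^sup>+x\<in>S. ennreal (\<bar>h x\<bar> powr s * w x) \<partial>lebesgue) < \<infinity>}"

text \<open>
  The integrands are non-negative, so the integrals are taken in \<open>[0, \<infinity>]\<close>; equating them with
  finite values says that they converge. The convention \<open>0 powr a = 0\<close> also for \<open>a = 0\<close> affects
  the weight \<open>norm y powr (- \<alpha>)\<close> only at the single boundary point \<open>y = 0\<close>, a null set.
\<close>

definition solves_system ::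
    "real \<Rightarrow> real \<Rightarrow> real \<Rightarrow> real \<Rightarrow> real \<Rightarrow> real \<Rightarrow>
     (real^'m \<Rightarrow> real) \<Rightarrow> ((real^'m) \<times> real \<Rightarrow> real) \<Rightarrow> bool" where
  "solves_system \<alpha> \<beta> lam \<mu> p\<^sub>0 q\<^sub>0 u v \<longleftrightarrow>
     (\<forall>y. ennreal (u y) =
        (\<integral>\<^sup>+x\<in>half_space. ennreal (norm x powr (- \<beta>) * poisson_kernel lam x y \<mu> * v x powr q\<^sub>0)
           \<partial>lebesgue)) \<and>
     (\<forall>x\<in>half_space. ennreal (v x) =
        (\<integral>\<^sup>+y. ennreal (norm y powr (- \<alpha>) * poisson_kernel lam x y \<mu> * u y powr p\<^sub>0)
           \<partial>lebesgue))"

end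

theory Submission
  imports Defs
begin

text \<open>
  Let \<open>f t = \<integral> u(t y) u(y)\<^sup>p |y|\<^sup>-\<^sup>\<alpha> dy\<close>. Young's inequality and a linear change of variables bound \<open>f\<close> by an
  explicit function of \<open>t\<close> with equality at \<open>t = 1\<close>. The system and the homogeneity of the kernel
  turn \<open>f t\<close> into a multiple of \<open>\<integral> v(x/t) v(x)\<^sup>q |x|\<^sup>-\<^sup>\<beta> dx\<close>, and the same argument gives a second
  bound with equality at \<open>t = 1\<close>. If \<open>f\<close> is differentiable at \<open>1\<close>, all three functions have the same
  derivative there, which is the claimed relation.

  Since \<open>u\<close> is only locally \<open>C\<^sup>1\<close>, the cutoff \<open>\<eta>(y) = bump (|y| / R)\<close> is put into \<open>f\<close>. Moving it from
  \<open>y\<close> to \<open>x\<close> leaves the double integral of \<open>(\<eta>(y) - \<eta>(x/t)) K(x, t y)\<close>. The first factor vanishes to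
  first order where the kernel is singular, so this term is differentiable at \<open>t = 1\<close>, with a
  derivative dominated uniformly in \<open>R\<close> that tends to \<open>0\<close> as \<open>R\<close> grows.
\<close>

subsection \<open>Differentiation under the integral and changes of variables\<close>

text \<open>Fatou's lemma for the non-negative functions
  \<open>g k + g0 - \<bar>f k - f0\<bar>\<close>, which converge to \<open>2 * g0\<close>, forces
  the integral of \<open>\<bar>f k - f0\<bar>\<close> to tend to 0. The majorant may vary with
  \<open>k\<close>, because Young's inequality bounds the dilated integrands by functions that
  depend on the dilation.\<close>

lemma generalized_dominated_convergence:
  fixes f g :: "nat \<Rightarrow> 'a \<Rightarrow> real" and f0 g0 :: "'a \<Rightarrow> real"
  assumes f[measurable]: "\<And>k. f k \<in> borel_measurable M"
    and g: "\<And>k. integrable M (g k)" "integrable M g0"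
    and bound: "\<And>k x. x \<in> space M \<Longrightarrow> \<bar>f k x\<bar> \<le> g k x"
    and limf: "\<And>x. x \<in> space M \<Longrightarrow> (\<lambda>k. f k x) \<longlonglongrightarrow> f0 x"
    and limg: "\<And>x. x \<in> space M \<Longrightarrow> (\<lambda>k. g k x) \<longlonglongrightarrow> g0 x"
    and lim: "(\<lambda>k. integral\<^sup>L M (g k)) \<longlonglongrightarrow> integral\<^sup>L M g0"
  shows "integrable M f0" "(\<lambda>k. integral\<^sup>L M (f k)) \<longlonglongrightarrow> integral\<^sup>L M f0"
proof -
  have f0[measurable]: "f0 \<in> borel_measurable M"
    using borel_measurable_LIMSEQ_real[OF limf f] by simp
  have bound0: "\<bar>f0 x\<bar> \<le> g0 x" if "x \<in> space M" for x
    using bound[OF that] tendsto_rabs[OF limf[OF that]] limg[OF that]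
    by (meson LIMSEQ_le)
  show if0: "integrable M f0"
    by (rule Bochner_Integration.integrable_bound[OF g(2)])
       (auto intro!: AE_I2 order.trans[OF bound0])
  have if': "integrable M (f k)" for k
    by (rule Bochner_Integration.integrable_bound[OF g(1)[of k]])
       (auto intro!: AE_I2 order.trans[OF bound])
  define h where "h k x = g k x + g0 x - \<bar>f k x - f0 x\<bar>" for k x
  define D where "D k = (\<integral>x. \<bar>f k x - f0 x\<bar> \<partial>M)" for k
  define G where "G = integral\<^sup>L M g0"
  have ih: "integrable M (h k)" for k
    unfolding h_def using if' if0 g by auto
  have Ih: "integral\<^sup>L M (h k) = integral\<^sup>L M (g k) + G - D k" for k
    unfolding h_def D_def G_def using if' if0 g by simp
  have h0: "0 \<le> h k x" if "x \<in> space M" for k x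
    using bound[OF that, of k] bound0[OF that] unfolding h_def by linarith
  have limh: "(\<lambda>k. h k x) \<longlonglongrightarrow> 2 * g0 x" if "x \<in> space M" for x
  proof -
    have "(\<lambda>k. g k x + g0 x - \<bar>f k x - f0 x\<bar>) \<longlonglongrightarrow> g0 x + g0 x - \<bar>f0 x - f0 x\<bar>"
      by (intro tendsto_intros limf limg that)
    then show ?thesis by (simp add: h_def)
  qed
  have "ennreal (2 * G) = (\<integral>\<^sup>+x. ennreal (2 * g0 x) \<partial>M)"
    unfolding G_def using g(2) bound0
    by (subst nn_integral_eq_integral) (auto intro!: AE_I2 order.trans[OF abs_ge_zero])
  also have "\<dots> = (\<integral>\<^sup>+x. liminf (\<lambda>k. ennreal (h k x)) \<partial>M)"
    by (intro nn_integral_cong lim_imp_Liminf[symmetric] tendsto_ennrealI limh) auto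
  also have "\<dots> \<le> liminf (\<lambda>k. \<integral>\<^sup>+x. ennreal (h k x) \<partial>M)"
    using ih by (intro nn_integral_liminf) (auto intro: borel_measurable_integrable)
  also have "(\<lambda>k. \<integral>\<^sup>+x. ennreal (h k x) \<partial>M) = (\<lambda>k. ennreal (integral\<^sup>L M (h k)))"
    using ih h0 by (intro ext nn_integral_eq_integral) auto
  finally have main: "ennreal (2 * G) \<le> liminf (\<lambda>k. ennreal (integral\<^sup>L M (h k)))" .
  have hk0: "0 \<le> integral\<^sup>L M (h k)" for k
    using h0 by (intro integral_nonneg_AE) auto
  have D0: "0 \<le> D k" for k unfolding D_def by simp
  have "D \<longlonglongrightarrow> 0"
  proof (rule LIMSEQ_I)
    fix e :: real assume e: "0 < e"
    have "\<forall>\<^sub>F k in sequentially. 2 * G - e/2 < integral\<^sup>L M (h k)"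
    \<comment> \<open>\<open>ennreal\<close> sends negative reals to 0, so the bound from Fatou's
      lemma transfers back to the reals only when \<open>2 * G - e/2\<close> is non-negative;
      otherwise the non-negativity of the integrals is enough.\<close>
    proof (cases "2 * G - e/2 < 0")
      case True
      then show ?thesis by (intro always_eventually allI less_le_trans[OF _ hk0])
    next
      case False
      then have "ennreal (2 * G - e/2) < ennreal (2 * G)"
        using e by (subst ennreal_less_iff) auto
      then have "ennreal (2 * G - e/2) < liminf (\<lambda>k. ennreal (integral\<^sup>L M (h k)))"
        using main by simp
      then have "\<forall>\<^sub>F k in sequentially. ennreal (2 * G - e/2) < ennreal (integral\<^sup>L M (h k))"
        by (rule less_LiminfD)
      then show ?thesis by eventually_elim (use False in \<open>simp add: ennreal_less_iff\<close>)
    qed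
    moreover have "\<forall>\<^sub>F k in sequentially. integral\<^sup>L M (g k) < G + e/2"
      using lim e unfolding G_def by (intro order_tendstoD) auto
    ultimately have "\<forall>\<^sub>F k in sequentially. norm (D k - 0) < e"
    proof eventually_elim
      case (elim k)
      then show ?case using D0[of k] unfolding Ih by simp
    qed
    then show "\<exists>no. \<forall>k\<ge>no. norm (D k - 0) < e" by (simp add: eventually_sequentially)
  qed
  have diff: "norm (integral\<^sup>L M (f k) - integral\<^sup>L M f0) \<le> D k" for k
  proof -
    have "integral\<^sup>L M (f k) - integral\<^sup>L M f0 = (\<integral>x. f k x - f0 x \<partial>M)"
      using if' if0 by simp
    then show ?thesis unfolding D_def using integral_abs_bound by (metis real_norm_def)
  qed
  have "(\<lambda>k. integral\<^sup>L M (f k) - integral\<^sup>L M f0) \<longlonglongrightarrow> 0"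
    by (rule Lim_null_comparison[OF always_eventually \<open>D \<longlonglongrightarrow> 0\<close>]) (use diff in blast)
  then show "(\<lambda>k. integral\<^sup>L M (f k)) \<longlonglongrightarrow> integral\<^sup>L M f0"
    by (rule LIM_zero_cancel)
qed

text \<open>Limits at \<open>c\<close> are tested along sequences in \<open>S - {c}\<close>. The
  point \<open>c\<close> itself is left out of the hypotheses on \<open>f\<close>, since difference
  quotients carry no information there.\<close>

lemma generalized_dominated_convergence_at:
  fixes f g :: "real \<Rightarrow> 'a \<Rightarrow> real" and f0 :: "'a \<Rightarrow> real"
  assumes S: "open S" "c \<in> S"
    and f: "\<And>t. t \<in> S - {c} \<Longrightarrow> f t \<in> borel_measurable M"
    and g: "\<And>t. t \<in> S \<Longrightarrow> integrable M (g t)"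
    and bound: "\<And>t x. t \<in> S - {c} \<Longrightarrow> x \<in> space M \<Longrightarrow> \<bar>f t x\<bar> \<le> g t x"
    and limf: "\<And>x. x \<in> space M \<Longrightarrow> ((\<lambda>t. f t x) \<longlongrightarrow> f0 x) (at c)"
    and limg: "\<And>x. x \<in> space M \<Longrightarrow> ((\<lambda>t. g t x) \<longlongrightarrow> g c x) (at c)"
    and lim: "((\<lambda>t. integral\<^sup>L M (g t)) \<longlongrightarrow> integral\<^sup>L M (g c)) (at c)"
  shows "integrable M f0" "((\<lambda>t. integral\<^sup>L M (f t)) \<longlongrightarrow> integral\<^sup>L M f0) (at c)"
proof -
  have seq: "(h \<longlongrightarrow> l) (at c) \<longleftrightarrow>
      (\<forall>X. (\<forall>i. X i \<in> S - {c}) \<longrightarrow> X \<longlonglongrightarrow> c \<longrightarrow> (\<lambda>i. h (X i)) \<longlonglongrightarrow> l)" for h and l :: real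
    using tendsto_at_iff_sequentially[of h l c S]
    unfolding at_within_open[OF S(2,1)] comp_def .
  have *: "integrable M f0 \<and> (\<lambda>i. integral\<^sup>L M (f (X i))) \<longlonglongrightarrow> integral\<^sup>L M f0"
    if X: "\<forall>i. X i \<in> S - {c}" "X \<longlonglongrightarrow> c" for X
  proof (intro conjI)
    have X': "X i \<in> S - {c}" for i using X by blast
    have l: "(\<lambda>i. h (X i)) \<longlonglongrightarrow> l" if "(h \<longlongrightarrow> l) (at c)" for h and l :: real
      using that X unfolding seq by blast
    have XS: "X i \<in> S" for i using X' by blast
    note gd = generalized_dominated_convergence[of "\<lambda>i. f (X i)" M "\<lambda>i. g (X i)" "g c" f0,
        OF f[OF X'] g[OF XS] g[OF S(2)] bound[OF X'] l[OF limf] l[OF limg] l[OF lim]]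
    show "integrable M f0" by (rule gd)
    show "(\<lambda>i. integral\<^sup>L M (f (X i))) \<longlonglongrightarrow> integral\<^sup>L M f0" by (rule gd)
  qed
  show "((\<lambda>t. integral\<^sup>L M (f t)) \<longlongrightarrow> integral\<^sup>L M f0) (at c)"
    unfolding seq using * by blast
  \<comment> \<open>Integrability of the limit does not mention \<open>t\<close>, so one sequence
    approaching \<open>c\<close> inside \<open>S\<close> must be exhibited.\<close>
  have "c islimpt S"
    using S by (simp add: interior_limit_point interior_open)
  then obtain X where "\<forall>i. X i \<in> S - {c}" "X \<longlonglongrightarrow> c"
    unfolding islimpt_sequential by blast
  with * show "integrable M f0" by blast
qed

text \<open>The difference quotients are dominated by \<open>G t\<close>, whose integrals converge.
  The third conclusion passes this bound to the limit, so that the derivative comes with its own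
  integrable majorant.\<close>

lemma has_real_derivative_integral:
  fixes F G :: "real \<Rightarrow> 'a \<Rightarrow> real" and D :: "'a \<Rightarrow> real"
  assumes S: "open S" "c \<in> S"
    and F: "\<And>t. t \<in> S \<Longrightarrow> integrable M (F t)"
    and G: "\<And>t. t \<in> S \<Longrightarrow> integrable M (G t)"
    and bound: "\<And>t x. t \<in> S \<Longrightarrow> x \<in> space M \<Longrightarrow> \<bar>F t x - F c x\<bar> \<le> \<bar>t - c\<bar> * G t x"
    and D: "\<And>x. x \<in> space M \<Longrightarrow> ((\<lambda>t. F t x) has_real_derivative D x) (at c)"
    and limG: "\<And>x. x \<in> space M \<Longrightarrow> ((\<lambda>t. G t x) \<longlongrightarrow> G c x) (at c)"
    and lim: "((\<lambda>t. integral\<^sup>L M (G t)) \<longlongrightarrow> integral\<^sup>L M (G c)) (at c)"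
  shows "integrable M D"
    and "((\<lambda>t. integral\<^sup>L M (F t)) has_real_derivative integral\<^sup>L M D) (at c)"
    and "\<And>x. x \<in> space M \<Longrightarrow> \<bar>D x\<bar> \<le> G c x"
proof -
  define Q where "Q t x = (F t x - F c x) / (t - c)" for t x
  have Qb: "\<bar>Q t x\<bar> \<le> G t x" if "t \<in> S - {c}" "x \<in> space M" for t x
    using bound[of t x] that unfolding Q_def by (auto simp: abs_divide field_simps)
  have Ql: "((\<lambda>t. Q t x) \<longlongrightarrow> D x) (at c)" if "x \<in> space M" for x
    using D[OF that] unfolding Q_def has_field_derivative_iff .
  have Qm: "Q t \<in> borel_measurable M" if "t \<in> S - {c}" for t
    unfolding Q_def using F S that
    by (intro borel_measurable_divide borel_measurable_diff) (auto intro: borel_measurable_integrable)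
  show "integrable M D"
    by (rule generalized_dominated_convergence_at(1)[OF S Qm G Qb Ql limG lim])
  have "((\<lambda>t. integral\<^sup>L M (Q t)) \<longlongrightarrow> integral\<^sup>L M D) (at c)"
    by (rule generalized_dominated_convergence_at(2)[OF S Qm G Qb Ql limG lim])
  moreover have "\<forall>\<^sub>F t in at c. t \<in> S"
    using S eventually_at_topological by blast
  then have "\<forall>\<^sub>F t in at c. integral\<^sup>L M (Q t) = (integral\<^sup>L M (F t) - integral\<^sup>L M (F c)) / (t - c)"
    by eventually_elim (use F S in \<open>simp add: Q_def[abs_def]\<close>)
  ultimately show "((\<lambda>t. integral\<^sup>L M (F t)) has_real_derivative integral\<^sup>L M D) (at c)"
    unfolding has_field_derivative_iff by (simp cong: tendsto_cong)
  show "\<bar>D x\<bar> \<le> G c x" if "x \<in> space M" for x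
  proof (rule tendsto_le[OF _ limG[OF that] tendsto_rabs[OF Ql[OF that]]])
    have "\<forall>\<^sub>F t in at c. t \<in> S - {c}"
      using S eventually_at_topological by blast
    then show "\<forall>\<^sub>F t in at c. \<bar>Q t x\<bar> \<le> G t x"
      by eventually_elim (use Qb that in blast)
  qed simp
qed

text \<open>The difference \<open>f - g\<close> has a local maximum at \<open>c\<close>. This reads
  off the derivative of \<open>f\<close> from an explicit upper bound that touches it.\<close>

lemma has_real_derivative_unique_touching:
  fixes f g :: "real \<Rightarrow> real"
  assumes "(f has_real_derivative a) (at c)" "(g has_real_derivative b) (at c)"
    and "f c = g c" "open S" "c \<in> S" "\<And>t. t \<in> S \<Longrightarrow> f t \<le> g t"
  shows "a = b"
proof -
  obtain e where e: "0 < e" "ball c e \<subseteq> S"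
    using assms openE by blast
  have "((\<lambda>t. f t - g t) has_real_derivative a - b) (at c)"
    by (intro derivative_intros assms)
  moreover have "\<forall>t. \<bar>c - t\<bar> < e \<longrightarrow> f t - g t \<le> f c - g c"
    using e assms by (auto simp: subset_eq dist_real_def)
  ultimately have "a - b = 0" using DERIV_local_max e(1) by blast
  then show ?thesis by simp
qed

section \<open>Dilations of Lebesgue integrals and elementary tools\<close>

lemma integral_lborel_scale:
  fixes F :: "'a::euclidean_space \<Rightarrow> real"
  assumes F: "integrable lborel F" and c: "0 < c"
  shows "integrable lborel (\<lambda>x. F (x /\<^sub>R c))"
    and "(\<integral>x. F (x /\<^sub>R c) \<partial>lborel) = c powr DIM('a) * (\<integral>x. F x \<partial>lborel)"
proof -
  have [measurable]: "F \<in> borel_measurable borel"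
    using F by auto
  have eq: "lborel = density (distr lborel borel (\<lambda>x::'a. c *\<^sub>R x)) (\<lambda>_. ennreal (c^DIM('a)))"
    using lborel_affine[of c "0::'a"] c by simp
  have m: "(\<lambda>x::'a. c *\<^sub>R x) \<in> measurable lborel borel" by simp
  have F': "(\<lambda>x. F (x /\<^sub>R c)) \<in> borel_measurable (distr lborel borel (\<lambda>x. c *\<^sub>R x))"
    and F'': "(\<lambda>x. c^DIM('a) *\<^sub>R F (x /\<^sub>R c)) \<in> borel_measurable borel"
    by measurable
  have nn: "AE x in distr lborel borel (\<lambda>x::'a. c *\<^sub>R x). 0 \<le> c ^ DIM('a)"
    using c by (intro AE_I2) simp
  have id: "(\<lambda>x. c^DIM('a) *\<^sub>R F ((c *\<^sub>R x) /\<^sub>R c)) = (\<lambda>x. c^DIM('a) * F x)"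
    using c by simp
  have "integrable lborel (\<lambda>x. c^DIM('a) *\<^sub>R F ((c *\<^sub>R x) /\<^sub>R c))"
    unfolding id using F by simp
  then have "integrable (density (distr lborel borel (\<lambda>x::'a. c *\<^sub>R x)) (\<lambda>_. ennreal (c^DIM('a))))
      (\<lambda>x. F (x /\<^sub>R c))"
    unfolding integrable_density[OF F' borel_measurable_const nn] integrable_distr_eq[OF m F''] .
  then show "integrable lborel (\<lambda>x. F (x /\<^sub>R c))"
    unfolding eq[symmetric] .
  have "(\<integral>x. F (x /\<^sub>R c) \<partial>density (distr lborel borel (\<lambda>x::'a. c *\<^sub>R x)) (\<lambda>_. ennreal (c^DIM('a))))
      = (\<integral>x. c^DIM('a) *\<^sub>R F ((c *\<^sub>R x) /\<^sub>R c) \<partial>lborel)"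
    unfolding integral_density[OF F' borel_measurable_const nn] integral_distr[OF m F''] ..
  then show "(\<integral>x. F (x /\<^sub>R c) \<partial>lborel) = c powr DIM('a) * (\<integral>x. F x \<partial>lborel)"
    unfolding eq[symmetric] id using c by (simp add: powr_realpow)
qed

text \<open>Young's inequality with the conjugate exponents \<open>p + 1\<close> and
  \<open>(p + 1) / p\<close>. Equality holds for \<open>a = b\<close>, which is what makes the
  resulting bounds touch at dilation 1.\<close>

lemma Young_powr:
  fixes a b p :: real
  assumes "0 \<le> a" "0 \<le> b" "0 < p"
  shows "a * b powr p \<le> a powr (p + 1) / (p + 1) + p / (p + 1) * b powr (p + 1)"
proof -
  have "a * b powr p \<le> a powr (p + 1) / (p + 1) + (b powr p) powr ((p+1)/p) / ((p+1)/p)"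
    using assms by (intro Youngs_inequality) (auto simp: field_simps)
  then show ?thesis using assms by (simp add: powr_powr mult.commute)
qed

lemma not_AE_open:
  assumes "open S" "S \<noteq> {}"
  shows "\<not> (AE x in (lborel :: 'a::euclidean_space measure). x \<notin> S)"
proof
  assume "AE x in (lborel :: 'a measure). x \<notin> S"
  then have "S \<in> null_sets lborel"
    using assms by (subst AE_iff_null_sets) auto
  then have "negligible S"
    by (simp add: negligible_iff_null_sets null_sets_completionI)
  with open_not_negligible assms show False by blast
qed

lemma integrable_bounded_mult:
  fixes f g :: "'x \<Rightarrow> real"
  assumes "integrable M f" "g \<in> borel_measurable M" "\<And>x. \<bar>g x\<bar> \<le> C"
  shows "integrable M (\<lambda>x. g x * f x)"
proof (rule Bochner_Integration.integrable_bound[OF integrable_mult_right[OF assms(1), of C]])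
  show "AE x in M. norm (g x * f x) \<le> norm (C * f x)"
  proof (intro AE_I2)
    fix x
    have "\<bar>g x\<bar> * \<bar>f x\<bar> \<le> \<bar>C\<bar> * \<bar>f x\<bar>"
      using assms(3)[of x] by (intro mult_right_mono) auto
    then show "norm (g x * f x) \<le> norm (C * f x)" by (simp add: abs_mult)
  qed
qed (use assms in \<open>auto intro: borel_measurable_integrable\<close>)

lemma fst_borel [measurable]: "fst \<in> measurable (borel :: ('a::euclidean_space \<times> 'b::euclidean_space) measure) borel"
  by (intro borel_measurable_continuous_onI continuous_intros)

lemma snd_borel [measurable]: "snd \<in> measurable (borel :: ('a::euclidean_space \<times> 'b::euclidean_space) measure) borel"
  by (intro borel_measurable_continuous_onI continuous_intros)

subsection \<open>The radial cutoff\<close>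

text \<open>The outer square makes the positive part of \<open>1 - r\<^sup>2\<close> continuously
  differentiable at the edge of the support \<open>[-1, 1]\<close>, with an explicit
  derivative.\<close>

definition bump :: "real \<Rightarrow> real" where
  "bump r = (max 0 (1 - r\<^sup>2))\<^sup>2"

lemma bump_range: "0 \<le> bump r" "bump r \<le> 1"
proof -
  show "0 \<le> bump r" by (simp add: bump_def)
  have "(max 0 (1 - r\<^sup>2))\<^sup>2 \<le> 1\<^sup>2" by (intro power_mono) auto
  then show "bump r \<le> 1" by (simp add: bump_def)
qed

lemma bump_0: "bump 0 = 1" by (simp add: bump_def)

lemma bump_eq_0: "1 \<le> \<bar>r\<bar> \<Longrightarrow> bump r = 0"
proof -
  assume "1 \<le> \<bar>r\<bar>"
  then have "1 \<le> r\<^sup>2" using one_le_power[of "\<bar>r\<bar>" 2] by simp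
  then show ?thesis by (simp add: bump_def)
qed

lemma has_real_derivative_max0_square:
  "((\<lambda>s::real. (max 0 s)\<^sup>2) has_real_derivative 2 * max 0 s) (at s)"
proof -
  consider "s < 0" | "0 < s" | "s = 0" by linarith
  then show ?thesis
  proof cases
    case 1
    have "((\<lambda>s. (max 0 s)\<^sup>2) has_real_derivative 0) (at s)"
      by (rule has_field_derivative_transform_within_open[of "\<lambda>_. 0" _ _ "{..<0}"])
         (use 1 in auto)
    then show ?thesis using 1 by simp
  next
    case 2
    have "((\<lambda>s. (max 0 s)\<^sup>2) has_real_derivative 2 * s) (at s)"
      by (rule has_field_derivative_transform_within_open[of "\<lambda>s. s\<^sup>2" _ _ "{0<..}"])
         (use 2 in \<open>auto intro!: derivative_eq_intros\<close>)
    then show ?thesis using 2 by simp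
  next
    case 3
    \<comment> \<open>At the kink the difference quotient is bounded by
      \<open>\<bar>h\<bar>\<close>.\<close>
    have "((\<lambda>h::real. (max 0 h)\<^sup>2 / h) \<longlongrightarrow> 0) (at 0)"
    proof (rule Lim_null_comparison)
      show "\<forall>\<^sub>F h::real in at 0. norm ((max 0 h)\<^sup>2 / h) \<le> \<bar>h\<bar>"
        by (intro always_eventually) (auto simp: max_def power2_eq_square)
      show "((\<lambda>h::real. \<bar>h\<bar>) \<longlongrightarrow> 0) (at 0)"
        by (rule tendsto_eq_intros) auto
    qed
    then show ?thesis using 3 by (simp add: DERIV_def)
  qed
qed

lemma has_real_derivative_bump:
  "(bump has_real_derivative (- 4 * r * max 0 (1 - r\<^sup>2))) (at r)"
proof -
  have "((\<lambda>r::real. 1 - r\<^sup>2) has_real_derivative - 2 * r) (at r)"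
    by (auto intro!: derivative_eq_intros)
  from DERIV_chain'[OF this has_real_derivative_max0_square]
  show ?thesis unfolding bump_def by (simp add: mult_ac)
qed

lemma continuous_on_bump [continuous_intros]:
  "continuous_on S f \<Longrightarrow> continuous_on S (\<lambda>x. bump (f x))"
  unfolding bump_def by (intro continuous_intros)

lemma borel_measurable_bump [measurable]: "bump \<in> borel_measurable borel"
  by (intro borel_measurable_continuous_onI continuous_on_bump continuous_on_id)

lemma bump_Lipschitz: "\<bar>bump a - bump b\<bar> \<le> 4 * \<bar>a - b\<bar>"
proof -
  have "norm (bump a - bump b) \<le> 4 * norm (a - b)"
  proof (rule field_differentiable_bound[of UNIV])
    fix r :: real
    show "(bump has_real_derivative (- 4 * r * max 0 (1 - r\<^sup>2))) (at r within UNIV)"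
      using has_real_derivative_bump by simp
    have "\<bar>r\<bar> * max 0 (1 - r\<^sup>2) \<le> 1"
    proof (cases "\<bar>r\<bar> \<le> 1")
      case True
      then have "\<bar>r\<bar> * max 0 (1 - r\<^sup>2) \<le> 1 * 1" by (intro mult_mono) auto
      then show ?thesis by simp
    next
      case False
      then have "1 \<le> r\<^sup>2" using one_le_power[of "\<bar>r\<bar>" 2] by simp
      then show ?thesis by (simp add: max_def)
    qed
    then show "norm (- 4 * r * max 0 (1 - r\<^sup>2)) \<le> 4"
      by (simp add: abs_mult)
  qed auto
  then show ?thesis by simp
qed

text \<open>The compact support pays for the growing weight \<open>b\<close>. For
  \<open>b \<le> 2\<close> the Lipschitz constant 4 is doubled; for \<open>b > 2\<close> the term
  \<open>bump b\<close> vanishes, and either \<open>bump a\<close> vanishes too or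
  \<open>a < 1\<close>, in which case \<open>b\<close> is at most twice the distance from
  \<open>a\<close> to \<open>b\<close>.\<close>

lemma bump_diff_mult_le:
  assumes "0 \<le> a" "0 \<le> b"
  shows "\<bar>bump a - bump b\<bar> * b \<le> 8 * \<bar>a - b\<bar>"
proof (cases "b \<le> 2")
  case True
  have "\<bar>bump a - bump b\<bar> * b \<le> (4 * \<bar>a - b\<bar>) * 2"
    using True assms by (intro mult_mono bump_Lipschitz) auto
  then show ?thesis by simp
next
  case False
  then have b: "bump b = 0" by (simp add: bump_eq_0)
  show ?thesis
  proof (cases "1 \<le> a")
    case True
    then show ?thesis using b by (simp add: bump_eq_0)
  next
    case a: False
    have "\<bar>bump a - bump b\<bar> * b \<le> 1 * b"
      using b bump_range[of a] assms by (intro mult_right_mono) auto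
    also have "1 * b \<le> 8 * \<bar>a - b\<bar>" using a False by auto
    finally show ?thesis .
  qed
qed

text \<open>The weighted bound for the pair \<open>s / t\<close>, \<open>s\<close> has a right-hand
  side proportional to \<open>s\<close>, which cancels; \<open>1 / t < 2\<close> doubles the 8.
  Uniformity in \<open>s\<close> later becomes uniformity in the cutoff radius.\<close>

lemma bump_dilation_bound:
  assumes "0 \<le> s" "t \<in> {1/2<..<2}"
  shows "\<bar>bump (s / t) - bump s\<bar> \<le> 16 * \<bar>t - 1\<bar>"
proof (cases "s = 0")
  case False
  have t: "0 < t" "1/2 < t" using assms by auto
  have "\<bar>bump (s / t) - bump s\<bar> * s \<le> 8 * \<bar>s / t - s\<bar>"
    using assms t by (intro bump_diff_mult_le) auto
  also have "s / t - s = (- s) * (t - 1) / t"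
    using t by (simp add: field_simps)
  also have "8 * \<bar>(- s) * (t - 1) / t\<bar> = 8 * (\<bar>t - 1\<bar> / t) * s"
    using t assms by (simp add: abs_mult)
  also have "\<bar>t - 1\<bar> / t \<le> \<bar>t - 1\<bar> / (1/2)"
    using t by (intro divide_left_mono) auto
  finally show ?thesis using False assms by simp
qed (simp add: bump_0)

text \<open>This is \<open>- s\<close> times the derivative of \<open>bump\<close> at
  \<open>s\<close>, that is, the rate of change of \<open>bump (s / t)\<close> in \<open>t\<close>
  at \<open>t = 1\<close>.\<close>

definition bump_rate :: "real \<Rightarrow> real" where
  "bump_rate s = 4 * s\<^sup>2 * max 0 (1 - s\<^sup>2)"

lemma has_real_derivative_bump_dilation:
  "((\<lambda>t. bump (s / t)) has_real_derivative bump_rate s) (at 1)"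
proof -
  have "((\<lambda>t. s / t) has_real_derivative - s) (at 1)"
    by (auto intro!: derivative_eq_intros)
  from DERIV_chain'[OF this, of bump "- 4 * s * max 0 (1 - s\<^sup>2)"] has_real_derivative_bump[of s]
  show ?thesis by (simp add: bump_rate_def power2_eq_square mult_ac)
qed

lemma bump_rate_bound: "\<bar>bump_rate s\<bar> \<le> 4"
proof (cases "\<bar>s\<bar> \<le> 1")
  case True
  have "s\<^sup>2 \<le> 1" using True by (simp add: abs_square_le_1)
  then have "s\<^sup>2 * max 0 (1 - s\<^sup>2) \<le> 1 * 1" by (intro mult_mono) auto
  then show ?thesis by (simp add: bump_rate_def abs_mult)
next
  case False
  then have "1 \<le> s\<^sup>2" using one_le_power[of "\<bar>s\<bar>" 2] by simp
  then show ?thesis by (simp add: bump_rate_def max_def)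
qed

lemma borel_measurable_bump_rate [measurable]: "bump_rate \<in> borel_measurable borel"
  unfolding bump_rate_def by (intro borel_measurable_continuous_onI continuous_intros)

lemma tendsto_bump_dilate: "(\<lambda>k. bump (s / real (Suc k))) \<longlonglongrightarrow> 1"
proof -
  have "(\<lambda>k. (max 0 (1 - (s / real (Suc k))\<^sup>2))\<^sup>2) \<longlonglongrightarrow> (max 0 (1 - 0\<^sup>2))\<^sup>2"
    by (intro tendsto_intros LIMSEQ_Suc[OF lim_const_over_n])
  then show ?thesis by (simp add: bump_def)
qed

lemma tendsto_bump_rate_dilate: "(\<lambda>k. bump_rate (s / real (Suc k))) \<longlonglongrightarrow> 0"
proof -
  have "(\<lambda>k. 4 * (s / real (Suc k))\<^sup>2 * (max 0 (1 - (s / real (Suc k))\<^sup>2))) \<longlonglongrightarrow> 4 * 0\<^sup>2 * (max 0 (1 - 0\<^sup>2))"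
    by (intro tendsto_intros LIMSEQ_Suc[OF lim_const_over_n])
  then show ?thesis by (simp add: bump_rate_def)
qed

lemma has_real_derivative_integral_bump:
  fixes g :: "'a::euclidean_space \<Rightarrow> real"
  assumes g: "integrable lborel g" and R: "0 < R"
  shows "((\<lambda>t. \<integral>x. bump (norm x / R / t) * g x \<partial>lborel) has_real_derivative
      (\<integral>x. bump_rate (norm x / R) * g x \<partial>lborel)) (at 1)"
proof (rule has_real_derivative_integral(2)[where S = "{1/2<..<2}" and G = "\<lambda>t x. 16 * \<bar>g x\<bar>"])
  have [measurable]: "g \<in> borel_measurable borel" using g by auto
  show "integrable lborel (\<lambda>x. bump (norm x / R / t) * g x)" for t
    using bump_range by (intro Bochner_Integration.integrable_bound[OF g])
      (auto intro!: AE_I2 mult_left_le_one_le simp: abs_mult)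
  show "integrable lborel (\<lambda>x. 16 * \<bar>g x\<bar>)" using g by simp
  show "\<bar>bump (norm x / R / t) * g x - bump (norm x / R / 1) * g x\<bar> \<le> \<bar>t - 1\<bar> * (16 * \<bar>g x\<bar>)"
    if "t \<in> {1/2<..<2}" for t x
  proof -
    have "\<bar>bump (norm x / R / t) * g x - bump (norm x / R / 1) * g x\<bar>
        = \<bar>bump (norm x / R / t) - bump (norm x / R)\<bar> * \<bar>g x\<bar>"
      by (simp add: left_diff_distrib[symmetric] abs_mult)
    also have "\<dots> \<le> (16 * \<bar>t - 1\<bar>) * \<bar>g x\<bar>"
      using bump_dilation_bound[of "norm x / R" t] R that by (intro mult_right_mono) auto
    finally show ?thesis by simp
  qed
  show "((\<lambda>t. bump (norm x / R / t) * g x) has_real_derivative bump_rate (norm x / R) * g x) (at 1)" for x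
    by (intro DERIV_cmult_right has_real_derivative_bump_dilation)
qed auto

lemma tendsto_integral_cutoff:
  fixes e :: "'x::euclidean_space \<Rightarrow> real"
  assumes e: "integrable lborel e"
  shows "(\<lambda>k. \<integral>y. bump (norm y / real (Suc k)) * e y \<partial>lborel) \<longlonglongrightarrow> (\<integral>y. e y \<partial>lborel)"
    and "(\<lambda>k. \<integral>y. bump_rate (norm y / real (Suc k)) * e y \<partial>lborel) \<longlonglongrightarrow> 0"
proof -
  have [measurable]: "e \<in> borel_measurable borel" using e by auto
  show "(\<lambda>k. \<integral>y. bump (norm y / real (Suc k)) * e y \<partial>lborel) \<longlonglongrightarrow> (\<integral>y. e y \<partial>lborel)"
  proof (rule integral_dominated_convergence[where w = "\<lambda>y. \<bar>e y\<bar>"])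
    show "AE y in lborel. (\<lambda>k. bump (norm y / real (Suc k)) * e y) \<longlonglongrightarrow> e y"
      using tendsto_mult[OF tendsto_bump_dilate tendsto_const] by (intro AE_I2) fastforce
    show "AE y in lborel. norm (bump (norm y / real (Suc k)) * e y) \<le> \<bar>e y\<bar>" for k
      using bump_range by (intro AE_I2) (simp add: abs_mult mult_left_le_one_le)
  qed (use e in auto)
  have "(\<lambda>k. \<integral>y. bump_rate (norm y / real (Suc k)) * e y \<partial>lborel) \<longlonglongrightarrow> (\<integral>y. 0 \<partial>(lborel :: 'x measure))"
  proof (rule integral_dominated_convergence[where w = "\<lambda>y. 4 * \<bar>e y\<bar>"])
    show "AE y in lborel. (\<lambda>k. bump_rate (norm y / real (Suc k)) * e y) \<longlonglongrightarrow> 0"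
      using tendsto_mult[OF tendsto_bump_rate_dilate tendsto_const] by (intro AE_I2) fastforce
    show "AE y in lborel. norm (bump_rate (norm y / real (Suc k)) * e y) \<le> 4 * \<bar>e y\<bar>" for k
      using bump_rate_bound by (intro AE_I2) (simp add: abs_mult mult_right_mono)
  qed (use e in auto)
  then show "(\<lambda>k. \<integral>y. bump_rate (norm y / real (Suc k)) * e y \<partial>lborel) \<longlonglongrightarrow> 0" by simp
qed

text \<open>The weighted bound for \<open>bump\<close> with \<open>a = norm x / (R * t)\<close> and
  \<open>b = norm y / R\<close>; the radius cancels. The difference of the cutoffs at
  \<open>y\<close> and \<open>x / t\<close> thus decays linearly at the kernel's singularity
  \<open>x = (t *\<^sub>R y, 0)\<close>, even after multiplication by \<open>norm y\<close>, the
  factor produced by moving the pole.\<close>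

lemma cutoff_diff_bound:
  assumes R: "0 < R" and t: "t \<in> {1/2<..<2}"
  shows "\<bar>bump (norm (y :: real^'m) / R) - bump (norm x / R / t)\<bar> * norm y \<le> 16 * norm (x - (t *\<^sub>R y, 0))"
proof -
  have t0: "0 < t" "1/2 < t" using t by auto
  have "\<bar>bump (norm x / R / t) - bump (norm y / R)\<bar> * (norm y / R) \<le> 8 * \<bar>norm x / R / t - norm y / R\<bar>"
    using R t0 by (intro bump_diff_mult_le) auto
  also have "norm x / R / t - norm y / R = (norm x - norm (t *\<^sub>R y, 0::real)) / (R * t)"
    using R t0 by (simp add: field_simps norm_Pair real_sqrt_mult)
  also have "8 * \<bar>(norm x - norm (t *\<^sub>R y, 0::real)) / (R * t)\<bar> \<le> 8 * (norm (x - (t *\<^sub>R y, 0)) / (R * t))"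
    using R t0 norm_triangle_ineq3[of x "(t *\<^sub>R y, 0)"] by (simp add: divide_right_mono)
  finally have "\<bar>bump (norm x / R / t) - bump (norm y / R)\<bar> * norm y \<le> 8 * norm (x - (t *\<^sub>R y, 0)) / t"
    using R by (simp add: field_simps)
  also have "\<dots> \<le> 8 * norm (x - (t *\<^sub>R y, 0)) / (1/2)"
    using t0 by (intro divide_left_mono) auto
  finally show ?thesis by (simp add: abs_minus_commute)
qed

subsection \<open>The kernel\<close>

text \<open>With \<open>b = a * (1 + x)\<close>, this is the Bernoulli-type bound
  \<open>(1 + x) powr - \<mu> \<ge> 1 - \<mu> * x\<close>, obtained from
  \<open>ln (1 + x) \<le> x\<close> and the tangent line of \<open>exp\<close>.\<close>

lemma powr_neg_diff_le:
  fixes a b \<mu> :: real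
  assumes "0 < a" "a \<le> b" "0 < \<mu>"
  shows "\<bar>a powr - \<mu> - b powr - \<mu>\<bar> \<le> \<mu> * (b - a) / a * a powr - \<mu>"
proof -
  define x where "x = (b - a) / a"
  have x: "0 \<le> x" "b = a * (1 + x)" using assms by (auto simp: x_def field_simps)
  have "1 - \<mu> * x \<le> 1 + (- \<mu> * ln (1 + x))"
    using ln_add_one_self_le_self[OF x(1)] assms by (simp add: mult_left_mono)
  also have "\<dots> \<le> exp (- \<mu> * ln (1 + x))" by (rule exp_ge_add_one_self)
  also have "\<dots> = (1 + x) powr - \<mu>" using x by (simp add: powr_def)
  finally have "a powr - \<mu> * (1 - \<mu> * x) \<le> a powr - \<mu> * (1 + x) powr - \<mu>"
    by (intro mult_left_mono) auto
  also have "\<dots> = b powr - \<mu>" using x assms by (simp add: powr_mult)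
  finally have "a powr - \<mu> - b powr - \<mu> \<le> \<mu> * x * a powr - \<mu>"
    by (simp add: algebra_simps)
  moreover have "b powr - \<mu> \<le> a powr - \<mu>"
    using assms by (intro powr_mono2') auto
  ultimately show ?thesis by (simp add: x_def)
qed

text \<open>In the application \<open>a\<close> and \<open>b\<close> are the distances from
  \<open>x\<close> to two positions of the pole, \<open>h\<close> and \<open>k\<close> the matching
  cutoff differences, \<open>l\<close> is \<open>norm y\<close> and \<open>d\<close> is the change
  of the dilation. Writing the difference as \<open>(k - h) * b powr - \<mu> - h * (a powr - \<mu> -
  b powr - \<mu>)\<close>, the factor \<open>1 / a\<close> lost in the second term is absorbed by
  \<open>\<bar>h\<bar> * l \<le> C * a\<close>.\<close>

lemma commutator_bound_aux:
  fixes a b \<mu> C d l h k :: real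
  assumes "0 < a" "a \<le> b" "0 < \<mu>" and ab: "b - a \<le> d * l" and hl: "\<bar>h\<bar> * l \<le> C * a"
    and hk: "\<bar>k - h\<bar> \<le> C * d" and d: "0 \<le> d"
  shows "\<bar>k * b powr - \<mu> - h * a powr - \<mu>\<bar> \<le> d * (C * (1 + \<mu>) * (a powr - \<mu> + b powr - \<mu>))"
proof -
  have Cd: "0 \<le> C * d" using hk by linarith
  have "k * b powr - \<mu> - h * a powr - \<mu> = (k - h) * b powr - \<mu> - h * (a powr - \<mu> - b powr - \<mu>)"
    by (simp add: algebra_simps)
  also have "\<bar>\<dots>\<bar> \<le> \<bar>k - h\<bar> * b powr - \<mu> + \<bar>h\<bar> * \<bar>a powr - \<mu> - b powr - \<mu>\<bar>"
    by (rule order.trans[OF abs_triangle_ineq4]) (simp add: abs_mult)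
  also have "\<dots> \<le> C * d * b powr - \<mu> + \<bar>h\<bar> * (\<mu> * (b - a) / a * a powr - \<mu>)"
    using powr_neg_diff_le[OF assms(1-3)] hk by (intro add_mono mult_right_mono mult_left_mono) auto
  also have "\<bar>h\<bar> * (\<mu> * (b - a) / a * a powr - \<mu>) = \<bar>h\<bar> * (b - a) * (\<mu> / a * a powr - \<mu>)"
    by simp
  also have "\<dots> \<le> (\<bar>h\<bar> * (d * l)) * (\<mu> / a * a powr - \<mu>)"
    using assms by (intro mult_right_mono mult_left_mono) auto
  also have "\<dots> = d * (\<bar>h\<bar> * l) * (\<mu> / a * a powr - \<mu>)" by simp
  also have "\<dots> \<le> d * (C * a) * (\<mu> / a * a powr - \<mu>)"
    using assms by (intro mult_right_mono mult_left_mono) auto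
  also have "\<dots> = C * d * \<mu> * a powr - \<mu>" using assms by simp
  finally have "\<bar>k * b powr - \<mu> - h * a powr - \<mu>\<bar> \<le> C * d * b powr - \<mu> + C * d * \<mu> * a powr - \<mu>"
    by simp
  \<comment> \<open>Non-negative terms are added to make the bound symmetric in \<open>a\<close> and
    \<open>b\<close>, so that the two orderings can be treated alike.\<close>
  also have "\<dots> \<le> C * d * b powr - \<mu> + C * d * \<mu> * a powr - \<mu> + (C * d * a powr - \<mu> + C * d * \<mu> * b powr - \<mu>)"
    using Cd assms by simp
  also have "\<dots> = d * (C * (1 + \<mu>) * (a powr - \<mu> + b powr - \<mu>))"
    by (simp add: algebra_simps)
  finally show ?thesis .
qed

text \<open>The division must be by the smaller distance, so the roles of \<open>a\<close> and
  \<open>b\<close> are exchanged when \<open>b < a\<close>; this is why decay is required of both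
  \<open>h\<close> and \<open>k\<close>.\<close>

lemma commutator_bound:
  fixes a b \<mu> C d l h k :: real
  assumes "0 < a" "0 < b" "0 < \<mu>" and ab: "\<bar>b - a\<bar> \<le> d * l" and hl: "\<bar>h\<bar> * l \<le> C * a"
    and kl: "\<bar>k\<bar> * l \<le> C * b" and hk: "\<bar>k - h\<bar> \<le> C * d" and d: "0 \<le> d"
  shows "\<bar>k * b powr - \<mu> - h * a powr - \<mu>\<bar> \<le> d * (C * (1 + \<mu>) * (a powr - \<mu> + b powr - \<mu>))"
proof (cases "a \<le> b")
  case True
  then show ?thesis using assms by (intro commutator_bound_aux) auto
next
  case False
  then have "\<bar>h * a powr - \<mu> - k * b powr - \<mu>\<bar> \<le> d * (C * (1 + \<mu>) * (b powr - \<mu> + a powr - \<mu>))"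
    using assms by (intro commutator_bound_aux) auto
  then show ?thesis by (simp add: abs_minus_commute add.commute)
qed

text \<open>The square root in the product norm turns the exponent \<open>\<mu> / 2\<close> into
  \<open>\<mu>\<close>. In terms of the distance to \<open>(y, 0)\<close> the triangle inequality
  becomes applicable.\<close>

lemma poisson_kernel_eq:
  assumes "0 < snd x"
  shows "poisson_kernel lam x y \<mu> = snd x powr lam * norm (x - (y, 0)) powr - \<mu>"
proof -
  have "norm (x - (y, 0)) = sqrt ((norm (fst x - y))\<^sup>2 + (snd x)\<^sup>2)"
    by (simp add: norm_prod_def)
  also have "\<dots> = ((norm (fst x - y))\<^sup>2 + (snd x)\<^sup>2) powr (1/2)"
    by (rule powr_half_sqrt[symmetric]) simp
  finally have n: "norm (x - (y, 0)) powr - \<mu> = ((norm (fst x - y))\<^sup>2 + (snd x)\<^sup>2) powr (- (\<mu> / 2))"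
    by (simp only: powr_powr) simp
  show ?thesis
    unfolding n poisson_kernel_def powr_minus[of _ "\<mu> / 2"] divide_inverse[of "snd x powr lam"] ..
qed

lemma norm_dilation_pos:
  fixes x :: "'a::real_normed_vector \<times> real"
  assumes "0 < snd x"
  shows "0 < norm (x - (y, 0))"
  using assms by (cases x) (auto simp: zero_prod_def)

lemma poisson_kernel_nonneg: "0 \<le> poisson_kernel lam x y \<mu>"
  by (simp add: poisson_kernel_def)

text \<open>The kernel is homogeneous of degree \<open>lam - \<mu>\<close> under joint dilation of
  \<open>x\<close> and \<open>y\<close>; this exponent is the source of the right-hand side of the
  final relation.\<close>

lemma poisson_kernel_dilation:
  assumes "0 < snd x" "0 < t"
  shows "poisson_kernel lam x (t *\<^sub>R y) \<mu> = t powr (lam - \<mu>) * poisson_kernel lam (x /\<^sub>R t) y \<mu>"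
proof -
  have eq: "x - (t *\<^sub>R y, 0) = t *\<^sub>R (x /\<^sub>R t - (y, 0))"
    using assms by (cases x) (simp add: algebra_simps)
  have n: "norm (x - (t *\<^sub>R y, 0)) = t * norm (x /\<^sub>R t - (y, 0))"
    unfolding eq using assms by simp
  have s: "0 < snd (x /\<^sub>R t)" and sx: "snd x = t * snd (x /\<^sub>R t)"
    using assms by auto
  have "poisson_kernel lam x (t *\<^sub>R y) \<mu>
      = (t * snd (x /\<^sub>R t)) powr lam * (t * norm (x /\<^sub>R t - (y, 0))) powr - \<mu>"
    unfolding poisson_kernel_eq[OF assms(1)] n sx[symmetric] ..
  also have "\<dots> = (t powr lam * t powr - \<mu>) * (snd (x /\<^sub>R t) powr lam * norm (x /\<^sub>R t - (y, 0)) powr - \<mu>)"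
    using s assms by (subst (1 2) powr_mult) (auto simp del: snd_scaleR)
  also have "t powr lam * t powr - \<mu> = t powr (lam - \<mu>)"
    by (simp flip: powr_add)
  finally show ?thesis unfolding poisson_kernel_eq[OF s] .
qed

text \<open>Inside the half space the distance to a boundary point is never 0, so the norm and its
  power are differentiable.\<close>

lemma differentiable_poisson_kernel_dilation:
  assumes "0 < snd x"
  shows "(\<lambda>t. poisson_kernel lam x (t *\<^sub>R y) \<mu>) differentiable at 1"
proof -
  let ?f = "\<lambda>t. x - (t *\<^sub>R y, 0)"
  have "(?f has_derivative (\<lambda>t. 0 - (t *\<^sub>R y, 0))) (at 1)"
    by (intro derivative_intros)
  then have "?f differentiable at 1" by (rule differentiableI)
  then have "(\<lambda>t. norm (?f t)) differentiable at 1"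
    using norm_dilation_pos[OF assms, of y]
    by (intro differentiable_compose[OF differentiable_norm_at]) auto
  then obtain D where D: "((\<lambda>t. norm (?f t)) has_real_derivative D) (at 1)"
    unfolding real_differentiable_def by blast
  have "\<exists>D. ((\<lambda>t. snd x powr lam * norm (?f t) powr - \<mu>) has_real_derivative D) (at 1)"
    using norm_dilation_pos[OF assms, of y] DERIV_cmult[OF DERIV_fun_powr[OF D, of "- \<mu>"]] by fastforce
  then show ?thesis
    unfolding real_differentiable_def by (simp add: poisson_kernel_eq assms)
qed

lemma poisson_kernel_borel [measurable]:
  "(\<lambda>x. poisson_kernel lam x y \<mu>) \<in> borel_measurable borel"
  "(\<lambda>y. poisson_kernel lam x y \<mu>) \<in> borel_measurable borel"
  "(\<lambda>z. poisson_kernel lam (fst z) (t *\<^sub>R snd z) \<mu>) \<in> borel_measurable (borel \<Otimes>\<^sub>M borel)"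
  unfolding poisson_kernel_def by measurable

subsection \<open>The two energies and the dilated double integral\<close>

text \<open>The system in a normalised form: \<open>v\<close> is extended by 0 outside the half
  space, so that every integral runs over the whole space with respect to \<open>lborel\<close>, and
  \<open>u\<close> is strictly positive.\<close>

locale kernel_system =
  fixes \<alpha> \<beta> lam \<mu> p q :: real
    and u :: "real^'m \<Rightarrow> real"
    and u' :: "real^'m \<Rightarrow> (real^'m) \<Rightarrow>\<^sub>L real"
    and v :: "(real^'m) \<times> real \<Rightarrow> real"
  assumes p: "0 < p" and q: "0 < q" and mu: "0 < \<mu>"
    and u_deriv: "\<And>y. (u has_derivative blinfun_apply (u' y)) (at y)"
    and u'_cont: "continuous_on UNIV u'"
    and u_pos: "\<And>y. 0 < u y"
    and v_nonneg: "\<And>x. 0 \<le> v x"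
    and v_outside: "\<And>x. snd x \<le> 0 \<Longrightarrow> v x = 0"
    and v_borel [measurable]: "v \<in> borel_measurable borel"
    and u_eq: "\<And>y. ennreal (u y) =
      (\<integral>\<^sup>+x. ennreal (norm x powr - \<beta> * v x powr q * poisson_kernel lam x y \<mu>) \<partial>lborel)"
    and v_eq: "\<And>x. 0 < snd x \<Longrightarrow> ennreal (v x) =
      (\<integral>\<^sup>+y. ennreal (norm y powr - \<alpha> * u y powr p * poisson_kernel lam x y \<mu>) \<partial>lborel)"
    and energy: "integrable lborel (\<lambda>y. norm y powr - \<alpha> * u y powr (p + 1))"
begin

abbreviation w1 :: "real^'m \<Rightarrow> real" where
  "w1 y \<equiv> norm y powr - \<alpha> * u y powr p"

abbreviation w2 :: "(real^'m) \<times> real \<Rightarrow> real" where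
  "w2 x \<equiv> norm x powr - \<beta> * v x powr q"

definition e1 :: "real^'m \<Rightarrow> real" where
  "e1 y = norm y powr - \<alpha> * u y powr (p + 1)"

definition e2 :: "(real^'m) \<times> real \<Rightarrow> real" where
  "e2 x = norm x powr - \<beta> * v x powr (q + 1)"

text \<open>The double integrand behind both equations, with the dilation placed only inside the
  kernel. Integration over \<open>x\<close> uses the equation for \<open>u\<close>, integration over
  \<open>y\<close> the one for \<open>v\<close>.\<close>

definition P :: "real \<Rightarrow> ((real^'m) \<times> real) \<times> (real^'m) \<Rightarrow> real" where
  "P t z = w2 (fst z) * w1 (snd z) * poisson_kernel lam (fst z) (t *\<^sub>R snd z) \<mu>"

abbreviation L :: "(((real^'m) \<times> real) \<times> (real^'m)) measure" where
  "L \<equiv> lborel \<Otimes>\<^sub>M lborel"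

lemma u_cont: "continuous_on S u"
  using u_deriv by (meson continuous_at_imp_continuous_on has_derivative_continuous)

lemma u_borel [measurable]: "u \<in> borel_measurable borel"
  by (intro borel_measurable_continuous_onI u_cont)

lemma e1_eq: "e1 y = u y * w1 y"
  using u_pos[of y] by (simp add: e1_def powr_add)

lemma e2_eq: "e2 x = v x * w2 x"
  using v_nonneg[of x] q by (cases "v x = 0") (simp_all add: e2_def powr_add)

lemma e1_nonneg: "0 \<le> e1 y" and e2_nonneg: "0 \<le> e2 x"
  by (simp_all add: e1_def e2_def)

lemma P_nonneg: "0 \<le> P t z"
  by (simp add: P_def poisson_kernel_nonneg)

lemma P_borel [measurable]: "P t \<in> borel_measurable (borel \<Otimes>\<^sub>M borel)"
  unfolding P_def by measurable

lemma nn_integral_P_fst: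
  "(\<integral>\<^sup>+x. ennreal (P t (x, y)) \<partial>lborel) = ennreal (u (t *\<^sub>R y) * w1 y)"
proof -
  have "(\<integral>\<^sup>+x. ennreal (P t (x, y)) \<partial>lborel)
      = (\<integral>\<^sup>+x. ennreal (w1 y) * ennreal (w2 x * poisson_kernel lam x (t *\<^sub>R y) \<mu>) \<partial>lborel)"
    by (intro nn_integral_cong, subst ennreal_mult[symmetric])
       (auto simp: P_def mult_ac poisson_kernel_nonneg)
  also have "\<dots> = ennreal (w1 y) * ennreal (u (t *\<^sub>R y))"
    unfolding u_eq[of "t *\<^sub>R y"] by (rule nn_integral_cmult) measurable
  also have "\<dots> = ennreal (u (t *\<^sub>R y) * w1 y)"
    using u_pos[of "t *\<^sub>R y"] by (subst ennreal_mult[symmetric]) (auto simp: mult_ac)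
  finally show ?thesis .
qed

text \<open>Homogeneity moves the dilation from \<open>y\<close> to \<open>x\<close>, after which
  the equation for \<open>v\<close> applies at \<open>x /\<^sub>R t\<close>. Off the half space the
  weight \<open>w2 x\<close> is 0 because \<open>v\<close> vanishes there.\<close>

lemma nn_integral_P_snd:
  assumes t: "0 < t"
  shows "(\<integral>\<^sup>+y. ennreal (P t (x, y)) \<partial>lborel) = ennreal (t powr (lam - \<mu>) * v (x /\<^sub>R t) * w2 x)"
proof (cases "0 < snd x")
  case True
  have s: "0 < snd (x /\<^sub>R t)" using t True by simp
  have "(\<integral>\<^sup>+y. ennreal (P t (x, y)) \<partial>lborel)
      = (\<integral>\<^sup>+y. ennreal (w2 x * t powr (lam - \<mu>)) * ennreal (w1 y * poisson_kernel lam (x /\<^sub>R t) y \<mu>) \<partial>lborel)"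
    by (intro nn_integral_cong, subst ennreal_mult[symmetric])
       (auto simp: P_def mult_ac poisson_kernel_nonneg poisson_kernel_dilation[OF True t])
  also have "\<dots> = ennreal (w2 x * t powr (lam - \<mu>)) * ennreal (v (x /\<^sub>R t))"
    unfolding v_eq[OF s] by (rule nn_integral_cmult) measurable
  also have "\<dots> = ennreal (t powr (lam - \<mu>) * v (x /\<^sub>R t) * w2 x)"
    using v_nonneg[of "x /\<^sub>R t"] by (subst ennreal_mult[symmetric]) (auto simp: mult_ac)
  finally show ?thesis .
next
  case False
  then show ?thesis by (simp add: P_def v_outside)
qed

lemma integrable_e1: "integrable lborel e1"
  using energy by (simp add: e1_def[abs_def])

lemma e1_dilate: "0 < t \<Longrightarrow> norm y powr - \<alpha> * u (t *\<^sub>R y) powr (p + 1) = t powr \<alpha> * e1 (t *\<^sub>R y)"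
  by (cases "y = 0") (auto simp: e1_def powr_mult powr_minus field_simps)

lemma e2_dilate: "0 < t \<Longrightarrow> norm x powr - \<beta> * v (x /\<^sub>R t) powr (q + 1) = t powr - \<beta> * e2 (x /\<^sub>R t)"
  by (cases "x = 0") (auto simp: e2_def powr_mult powr_divide powr_minus field_simps)

text \<open>The substitution contributes \<open>t powr - CARD('m)\<close> and the weight
  \<open>t powr \<alpha>\<close>. The dilation leaves \<open>u\<close> and lands on the factor
  \<open>a\<close>.\<close>

lemma integral_e1_dilate:
  fixes a :: "real^'m \<Rightarrow> real"
  assumes a: "integrable lborel (\<lambda>y. a (y /\<^sub>R t) * e1 y)" and t: "0 < t"
  shows "integrable lborel (\<lambda>y. a y * (norm y powr - \<alpha> * u (t *\<^sub>R y) powr (p + 1)))"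
    and "(\<integral>y. a y * (norm y powr - \<alpha> * u (t *\<^sub>R y) powr (p + 1)) \<partial>lborel)
      = t powr (\<alpha> - CARD('m)) * (\<integral>y. a (y /\<^sub>R t) * e1 y \<partial>lborel)"
proof -
  have eq: "a y * (norm y powr - \<alpha> * u (t *\<^sub>R y) powr (p + 1))
      = t powr \<alpha> * (\<lambda>y. a (y /\<^sub>R t) * e1 y) (y /\<^sub>R inverse t)" for y
    using t by (simp add: e1_dilate)
  have t': "0 < inverse t" using t by simp
  note s = integral_lborel_scale[OF a t']
  show "integrable lborel (\<lambda>y. a y * (norm y powr - \<alpha> * u (t *\<^sub>R y) powr (p + 1)))"
    unfolding eq by (intro integrable_mult_right s(1))
  have "(\<integral>y. a y * (norm y powr - \<alpha> * u (t *\<^sub>R y) powr (p + 1)) \<partial>lborel)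
      = t powr \<alpha> * (inverse t powr CARD('m) * (\<integral>y. a (y /\<^sub>R t) * e1 y \<partial>lborel))"
    unfolding eq integral_mult_right_zero s(2) by simp
  also have "inverse t powr CARD('m) = t powr - CARD('m)"
    using t by (simp add: powr_minus inverse_powr)
  also have "t powr \<alpha> * (t powr - CARD('m) * (\<integral>y. a (y /\<^sub>R t) * e1 y \<partial>lborel))
      = t powr (\<alpha> - CARD('m)) * (\<integral>y. a (y /\<^sub>R t) * e1 y \<partial>lborel)"
    unfolding mult.assoc[symmetric] powr_add[symmetric] by simp
  finally show "(\<integral>y. a y * (norm y powr - \<alpha> * u (t *\<^sub>R y) powr (p + 1)) \<partial>lborel)
      = t powr (\<alpha> - CARD('m)) * (\<integral>y. a (y /\<^sub>R t) * e1 y \<partial>lborel)" .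
qed

text \<open>Here the dilation is inverse and the dimension is \<open>CARD('m) + 1\<close>, so both
  exponents have the opposite sign. The factor \<open>a\<close> is dilated along with
  \<open>v\<close>, so the substitution restores it.\<close>

lemma integral_e2_dilate:
  fixes a :: "(real^'m) \<times> real \<Rightarrow> real"
  assumes a: "integrable lborel (\<lambda>x. a x * e2 x)" and t: "0 < t"
  shows "integrable lborel (\<lambda>x. a (x /\<^sub>R t) * (norm x powr - \<beta> * v (x /\<^sub>R t) powr (q + 1)))"
    and "(\<integral>x. a (x /\<^sub>R t) * (norm x powr - \<beta> * v (x /\<^sub>R t) powr (q + 1)) \<partial>lborel)
      = t powr (CARD('m) + 1 - \<beta>) * (\<integral>x. a x * e2 x \<partial>lborel)"
proof -
  have eq: "a (x /\<^sub>R t) * (norm x powr - \<beta> * v (x /\<^sub>R t) powr (q + 1))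
      = t powr - \<beta> * (\<lambda>x. a x * e2 x) (x /\<^sub>R t)" for x
    using t by (simp add: e2_dilate)
  note s = integral_lborel_scale[OF a t]
  show "integrable lborel (\<lambda>x. a (x /\<^sub>R t) * (norm x powr - \<beta> * v (x /\<^sub>R t) powr (q + 1)))"
    unfolding eq by (intro integrable_mult_right s(1))
  have "(\<integral>x. a (x /\<^sub>R t) * (norm x powr - \<beta> * v (x /\<^sub>R t) powr (q + 1)) \<partial>lborel)
      = t powr - \<beta> * (t powr (CARD('m) + 1) * (\<integral>x. a x * e2 x \<partial>lborel))"
    unfolding eq integral_mult_right_zero s(2) by simp
  also have "\<dots> = t powr (CARD('m) + 1 - \<beta>) * (\<integral>x. a x * e2 x \<partial>lborel)"
    unfolding mult.assoc[symmetric] powr_add[symmetric] by simp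
  finally show "(\<integral>x. a (x /\<^sub>R t) * (norm x powr - \<beta> * v (x /\<^sub>R t) powr (q + 1)) \<partial>lborel)
      = t powr (CARD('m) + 1 - \<beta>) * (\<integral>x. a x * e2 x \<partial>lborel)" .
qed

section \<open>Young majorants and Fubini for the double integral\<close>

definition E :: real where "E = (\<integral>y. e1 y \<partial>lborel)"

text \<open>The upper bound that Young's inequality gives for
  \<open>u (t *\<^sub>R y) * w1 y\<close>; it equals \<open>e1 y\<close> at \<open>t = 1\<close>,
  and its integral is an explicit function of \<open>t\<close>.\<close>

definition young1 :: "real \<Rightarrow> real^'m \<Rightarrow> real" where
  "young1 t y = norm y powr - \<alpha> * u (t *\<^sub>R y) powr (p + 1) / (p + 1) + p / (p + 1) * e1 y"

definition young2 :: "real \<Rightarrow> (real^'m) \<times> real \<Rightarrow> real" where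
  "young2 t x = norm x powr - \<beta> * v (x /\<^sub>R t) powr (q + 1) / (q + 1) + q / (q + 1) * e2 x"

lemma young1_ge: "u (t *\<^sub>R y) * w1 y \<le> young1 t y"
proof -
  have "norm y powr - \<alpha> * (u (t *\<^sub>R y) * u y powr p) \<le> norm y powr - \<alpha> *
      (u (t *\<^sub>R y) powr (p + 1) / (p + 1) + p / (p + 1) * u y powr (p + 1))"
    using u_pos p by (intro mult_left_mono Young_powr) (auto intro: less_imp_le)
  then show ?thesis by (simp add: young1_def e1_def algebra_simps)
qed

lemma young2_ge: "v (x /\<^sub>R t) * w2 x \<le> young2 t x"
proof -
  have "norm x powr - \<beta> * (v (x /\<^sub>R t) * v x powr q) \<le> norm x powr - \<beta> *
      (v (x /\<^sub>R t) powr (q + 1) / (q + 1) + q / (q + 1) * v x powr (q + 1))"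
    using v_nonneg q by (intro mult_left_mono Young_powr) auto
  then show ?thesis by (simp add: young2_def e2_def algebra_simps)
qed

lemma integrable_young1: "0 < t \<Longrightarrow> integrable lborel (young1 t)"
  and integral_young1: "0 < t \<Longrightarrow>
    integral\<^sup>L lborel (young1 t) = (t powr (\<alpha> - CARD('m)) / (p + 1) + p / (p + 1)) * E"
proof -
  assume t: "0 < t"
  have "integrable lborel (\<lambda>y. (\<lambda>_. 1) (y /\<^sub>R t) * e1 y)" using integrable_e1 by simp
  note d = integral_e1_dilate[OF this t, unfolded mult_1]
  have y: "young1 t = (\<lambda>y. norm y powr - \<alpha> * u (t *\<^sub>R y) powr (p + 1) / (p + 1) + p / (p + 1) * e1 y)"
    by (simp add: young1_def[abs_def])
  show "integrable lborel (young1 t)"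
    unfolding y by (intro Bochner_Integration.integrable_add integrable_divide integrable_mult_right d(1) integrable_e1)
  have "integral\<^sup>L lborel (young1 t) =
      (\<integral>y. norm y powr - \<alpha> * u (t *\<^sub>R y) powr (p + 1) / (p + 1) \<partial>lborel) + (\<integral>y. p / (p + 1) * e1 y \<partial>lborel)"
    unfolding y by (intro Bochner_Integration.integral_add integrable_divide integrable_mult_right d(1) integrable_e1)
  also have "\<dots> = t powr (\<alpha> - CARD('m)) * E / (p + 1) + p / (p + 1) * E"
    unfolding integral_divide_zero integral_mult_right_zero d(2) E_def ..
  finally show "integral\<^sup>L lborel (young1 t) = (t powr (\<alpha> - CARD('m)) / (p + 1) + p / (p + 1)) * E"
    by (simp add: distrib_right)
qed

lemma integrable_u_dilate:
  assumes "0 < t"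
  shows "integrable lborel (\<lambda>y. u (t *\<^sub>R y) * w1 y)"
proof (rule Bochner_Integration.integrable_bound[OF integrable_young1[OF assms]])
  show "AE y in lborel. norm (u (t *\<^sub>R y) * w1 y) \<le> norm (young1 t y)"
    using young1_ge u_pos by (intro AE_I2) (simp add: abs_mult less_imp_le order.trans[OF _ abs_ge_self])
qed measurable

text \<open>By Tonelli, integrating in \<open>x\<close> first leaves
  \<open>u (t *\<^sub>R y) * w1 y\<close>, which the Young majorant controls.\<close>

lemma integrable_P:
  assumes "0 < t"
  shows "integrable L (P t)"
proof (rule integrableI_bounded)
  have "(\<integral>\<^sup>+z. ennreal (norm (P t z)) \<partial>L) = (\<integral>\<^sup>+y. (\<integral>\<^sup>+x. ennreal (P t (x, y)) \<partial>lborel) \<partial>lborel)"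
    by (subst lborel_pair.nn_integral_snd) (auto simp: P_nonneg)
  also have "\<dots> < \<infinity>"
    unfolding nn_integral_P_fst using integrable_u_dilate[OF assms]
    by (simp add: nn_integral_eq_integral AE_I2 less_imp_le[OF u_pos] ennreal_less_top)
  finally show "(\<integral>\<^sup>+z. ennreal (norm (P t z)) \<partial>L) < \<infinity>" .
qed measurable

lemma integral_P_snd_mult:
  fixes a :: "real^'m \<Rightarrow> real"
  assumes [measurable]: "a \<in> borel_measurable borel" and a: "\<And>y. \<bar>a y\<bar> \<le> C" and t: "0 < t"
  shows "integrable L (\<lambda>z. a (snd z) * P t z)"
    and "(\<integral>z. a (snd z) * P t z \<partial>L) = (\<integral>y. a y * (u (t *\<^sub>R y) * w1 y) \<partial>lborel)"
proof -
  show i: "integrable L (\<lambda>z. a (snd z) * P t z)"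
    by (rule integrable_bounded_mult[OF integrable_P[OF t] _ a]) measurable
  have "(\<integral>z. a (snd z) * P t z \<partial>L) = (\<integral>y. \<integral>x. a y * P t (x, y) \<partial>lborel \<partial>lborel)"
    using lborel_pair.integral_snd[of "\<lambda>x y. a y * P t (x, y)"] i by (simp add: case_prod_unfold)
  also have "(\<lambda>y. \<integral>x. a y * P t (x, y) \<partial>lborel) = (\<lambda>y. a y * (u (t *\<^sub>R y) * w1 y))"
  proof
    fix y
    have "(\<integral>x. P t (x, y) \<partial>lborel) = u (t *\<^sub>R y) * w1 y"
      using nn_integral_P_fst[of t y] u_pos[of "t *\<^sub>R y"]
      by (subst integral_eq_nn_integral) (auto simp: P_nonneg less_imp_le)
    then show "(\<integral>x. a y * P t (x, y) \<partial>lborel) = a y * (u (t *\<^sub>R y) * w1 y)" by simp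
  qed
  finally show "(\<integral>z. a (snd z) * P t z \<partial>L) = (\<integral>y. a y * (u (t *\<^sub>R y) * w1 y) \<partial>lborel)" .
qed

lemma integral_P_fst_mult:
  fixes a :: "(real^'m) \<times> real \<Rightarrow> real"
  assumes [measurable]: "a \<in> borel_measurable borel" and a: "\<And>x. \<bar>a x\<bar> \<le> C" and t: "0 < t"
  shows "integrable L (\<lambda>z. a (fst z) * P t z)"
    and "integrable lborel (\<lambda>x. a x * (t powr (lam - \<mu>) * v (x /\<^sub>R t) * w2 x))"
    and "(\<integral>z. a (fst z) * P t z \<partial>L) = (\<integral>x. a x * (t powr (lam - \<mu>) * v (x /\<^sub>R t) * w2 x) \<partial>lborel)"
proof -
  show i: "integrable L (\<lambda>z. a (fst z) * P t z)"
    by (rule integrable_bounded_mult[OF integrable_P[OF t] _ a]) measurable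
  have eq: "(\<lambda>x. \<integral>y. a x * P t (x, y) \<partial>lborel) = (\<lambda>x. a x * (t powr (lam - \<mu>) * v (x /\<^sub>R t) * w2 x))"
  proof
    fix x
    have "(\<integral>y. P t (x, y) \<partial>lborel) = t powr (lam - \<mu>) * v (x /\<^sub>R t) * w2 x"
      using nn_integral_P_snd[OF t, of x] v_nonneg[of "x /\<^sub>R t"]
      by (subst integral_eq_nn_integral) (auto simp: P_nonneg)
    then show "(\<integral>y. a x * P t (x, y) \<partial>lborel) = a x * (t powr (lam - \<mu>) * v (x /\<^sub>R t) * w2 x)" by simp
  qed
  show "(\<integral>z. a (fst z) * P t z \<partial>L) = (\<integral>x. a x * (t powr (lam - \<mu>) * v (x /\<^sub>R t) * w2 x) \<partial>lborel)"
    using lborel_pair.integral_fst[of "\<lambda>x y. a x * P t (x, y)"] i eq by (simp add: case_prod_unfold)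
  show "integrable lborel (\<lambda>x. a x * (t powr (lam - \<mu>) * v (x /\<^sub>R t) * w2 x))"
    using lborel_pair.integrable_fst[of "\<lambda>x y. a x * P t (x, y)"] i eq by (simp add: case_prod_unfold)
qed

lemma integral_P: "0 < t \<Longrightarrow> integral\<^sup>L L (P t) = (\<integral>y. u (t *\<^sub>R y) * w1 y \<partial>lborel)"
  using integral_P_snd_mult(2)[of "\<lambda>_. 1" 1 t] by simp

lemma integral_P_1: "integral\<^sup>L L (P 1) = E"
  by (simp add: integral_P E_def e1_eq)

text \<open>The two orders of integration of \<open>P 1\<close> produce the two energies.\<close>

lemma integrable_e2: "integrable lborel e2" and integral_e2: "integral\<^sup>L lborel e2 = E"
proof -
  have "e2 = (\<lambda>x. v x * w2 x)" by (simp add: fun_eq_iff e2_eq)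
  then show "integrable lborel e2" "integral\<^sup>L lborel e2 = E"
    using integral_P_fst_mult(2,3)[of "\<lambda>_. 1" 1 1] integral_P_1 by simp_all
qed

lemma E_pos: "0 < E"
proof -
  have "E \<noteq> 0"
  proof
    assume "E = 0"
    then have "AE y in lborel. e1 y = 0"
      using integral_nonneg_eq_0_iff_AE[OF integrable_e1] by (simp add: E_def e1_nonneg)
    \<comment> \<open>The origin is excluded because \<open>0 powr - \<alpha>\<close> is 0 by
      convention, which makes \<open>e1 0\<close> vanish although \<open>u 0\<close> is
      positive.\<close>
    moreover have "AE y in lborel. y \<noteq> (0 :: real^'m)"
      by (rule AE_lborel_singleton)
    ultimately have "AE y in (lborel :: (real^'m) measure). y \<notin> UNIV"
    proof eventually_elim
      case (elim y)
      then show ?case using u_pos[of y] by (simp add: e1_def)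
    qed
    then show False using not_AE_open[of "UNIV :: (real^'m) set"] by simp
  qed
  moreover have "0 \<le> E" by (simp add: E_def e1_nonneg)
  ultimately show ?thesis by simp
qed

lemma tendsto_u_dilate: "((\<lambda>t. u (t *\<^sub>R y)) \<longlongrightarrow> u y) (at 1)"
proof -
  have "isCont u y" using has_derivative_continuous[OF u_deriv] .
  moreover have "((\<lambda>t. t *\<^sub>R y) \<longlongrightarrow> 1 *\<^sub>R y) (at 1)"
    by (intro tendsto_intros)
  ultimately show ?thesis using isCont_tendsto_compose[of y u "\<lambda>t. t *\<^sub>R y" "at 1"] by simp
qed

text \<open>The majorant for the commutator contains \<open>P t\<close>, so its integral has to be
  continuous at 1. The dominating functions are \<open>young1 t\<close>, whose integrals are
  explicit powers of \<open>t\<close>.\<close>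

lemma tendsto_integral_P: "((\<lambda>t. integral\<^sup>L L (P t)) \<longlongrightarrow> integral\<^sup>L L (P 1)) (at 1)"
proof -
  let ?S = "{1/2<..<2::real}"
  have "((\<lambda>t. \<integral>y. u (t *\<^sub>R y) * w1 y \<partial>lborel) \<longlongrightarrow> (\<integral>y. u y * w1 y \<partial>lborel)) (at 1)"
  proof (rule generalized_dominated_convergence_at(2)[where S = ?S and g = young1])
    show "integrable lborel (young1 t)" if "t \<in> ?S" for t
      using that by (intro integrable_young1) simp
    show "\<bar>u (t *\<^sub>R y) * w1 y\<bar> \<le> young1 t y" for t y
      using young1_ge[of t y] u_pos[of "t *\<^sub>R y"] by (simp add: abs_mult)
    show "((\<lambda>t. u (t *\<^sub>R y) * w1 y) \<longlongrightarrow> u y * w1 y) (at 1)" for y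
      by (intro tendsto_intros tendsto_u_dilate)
    have "((\<lambda>t. norm y powr - \<alpha> * u (t *\<^sub>R y) powr (p + 1) / (p + 1) + p / (p + 1) * e1 y) \<longlongrightarrow>
        norm y powr - \<alpha> * u y powr (p + 1) / (p + 1) + p / (p + 1) * e1 y) (at 1)" for y
      using u_pos[of y] p by (intro tendsto_intros tendsto_u_dilate) auto
    then show "((\<lambda>t. young1 t y) \<longlongrightarrow> young1 1 y) (at 1)" for y
      by (simp add: young1_def)
    have "((\<lambda>t. (t powr (\<alpha> - CARD('m)) / (p + 1) + p / (p + 1)) * E) \<longlongrightarrow>
        (1 powr (\<alpha> - CARD('m)) / (p + 1) + p / (p + 1)) * E) (at 1)"
      using p by (intro tendsto_intros) auto
    moreover have "\<forall>\<^sub>F t in at 1. t \<in> ?S"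
      by (rule eventually_at_in_open') auto
    then have "\<forall>\<^sub>F t in at 1. integral\<^sup>L lborel (young1 t) =
        (t powr (\<alpha> - CARD('m)) / (p + 1) + p / (p + 1)) * E"
      by eventually_elim (simp add: integral_young1)
    ultimately show "((\<lambda>t. integral\<^sup>L lborel (young1 t)) \<longlongrightarrow> integral\<^sup>L lborel (young1 1)) (at 1)"
      by (simp add: integral_young1 tendsto_cong)
  qed auto
  moreover have "\<forall>\<^sub>F t in at 1. t \<in> ?S"
    by (rule eventually_at_in_open') auto
  then have "\<forall>\<^sub>F t in at 1. integral\<^sup>L L (P t) = (\<integral>y. u (t *\<^sub>R y) * w1 y \<partial>lborel)"
    by eventually_elim (simp add: integral_P)
  ultimately show ?thesis by (simp add: integral_P tendsto_cong)
qed

subsection \<open>The cutoff identity\<close>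

text \<open>The cutoff confines \<open>y\<close> to a ball of radius \<open>R\<close>, and
  \<open>t < 2\<close> keeps \<open>t *\<^sub>R y\<close> in the ball of radius
  \<open>2 * R\<close>, where the derivative of \<open>u\<close> is bounded by compactness. Only
  existence of the derivative is asserted; its value comes from comparison with the Young
  bounds.\<close>

lemma cutoff_u_differentiable:
  assumes R: "0 < R"
  obtains D where "((\<lambda>t. \<integral>y. bump (norm y / R) * (u (t *\<^sub>R y) * w1 y) \<partial>lborel) has_real_derivative D) (at 1)"
proof -
  have "compact ((\<lambda>y. norm (u' y)) ` cball 0 (2 * R))"
    by (intro compact_continuous_image continuous_on_norm continuous_on_subset[OF u'_cont]) auto
  then obtain B where "\<forall>y\<in>cball 0 (2 * R). norm (u' y) \<le> B"
    by (auto simp: bounded_iff dest!: compact_imp_bounded)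
  then have B: "norm (u' y) \<le> B" if "norm y \<le> 2 * R" for y using that by simp
  have B0: "0 \<le> B" using order.trans[OF norm_ge_zero B[of 0]] R by simp
  obtain y0 where "\<forall>y\<in>cball 0 R. u y0 \<le> u y"
    using continuous_attains_inf[of "cball 0 R" u] u_cont R by auto
  then have c: "u y0 \<le> u y" if "norm y \<le> R" for y using that by auto
  \<comment> \<open>Dividing by the positive minimum of \<open>u\<close> on the ball turns the
    absolute Lipschitz estimate into one relative to \<open>u y\<close>, so that the majorant is a
    multiple of the integrable \<open>e1\<close>.\<close>
  define C where "C = B * R / u y0"
  have C0: "0 \<le> C" using B0 R u_pos[of y0] by (simp add: C_def)
  have lip: "\<bar>u (t *\<^sub>R y) - u y\<bar> \<le> \<bar>t - 1\<bar> * (C * u y)"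
    if y: "norm y \<le> R" and t: "t \<in> {1/2<..<2}" for t y
  proof -
    have "norm (t *\<^sub>R y) \<le> 2 * R" using y t by (auto intro!: mult_mono)
    then have "norm (u (t *\<^sub>R y) - u y) \<le> B * norm (t *\<^sub>R y - y)"
      using y R B u_deriv
      by (intro differentiable_bound[of "cball 0 (2 * R)" u "\<lambda>y. blinfun_apply (u' y)"])
         (auto simp: norm_blinfun.rep_eq[symmetric] intro: has_derivative_at_withinI)
    also have "t *\<^sub>R y - y = (t - 1) *\<^sub>R y" by (simp add: algebra_simps)
    also have "B * norm ((t - 1) *\<^sub>R y) \<le> B * (\<bar>t - 1\<bar> * R)"
      using y B0 by (auto intro!: mult_left_mono)
    also have "\<dots> = \<bar>t - 1\<bar> * (C * u y0)"
      using u_pos[of y0] by (simp add: C_def)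
    also have "\<dots> \<le> \<bar>t - 1\<bar> * (C * u y)"
      using c[OF y] C0 by (intro mult_left_mono) auto
    finally show ?thesis by simp
  qed
  have "((\<lambda>t. \<integral>y. bump (norm y / R) * (u (t *\<^sub>R y) * w1 y) \<partial>lborel) has_real_derivative
      (\<integral>y. bump (norm y / R) * (blinfun_apply (u' y) y * w1 y) \<partial>lborel)) (at 1)"
  proof (rule has_real_derivative_integral(2)[where S = "{1/2<..<2}" and G = "\<lambda>t y. C * e1 y"])
    show "integrable lborel (\<lambda>y. bump (norm y / R) * (u (t *\<^sub>R y) * w1 y))" if "t \<in> {1/2<..<2}" for t
      using that bump_range by (intro integrable_bounded_mult[where C = 1] integrable_u_dilate) auto
    show "integrable lborel (\<lambda>y. C * e1 y)" using integrable_e1 by simp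
    show "\<bar>bump (norm y / R) * (u (t *\<^sub>R y) * w1 y) - bump (norm y / R) * (u (1 *\<^sub>R y) * w1 y)\<bar>
        \<le> \<bar>t - 1\<bar> * (C * e1 y)" if t: "t \<in> {1/2<..<2}" for t y
    proof (cases "norm y \<le> R")
      case True
      have "bump (norm y / R) * (u (t *\<^sub>R y) * w1 y) - bump (norm y / R) * (u (1 *\<^sub>R y) * w1 y)
          = bump (norm y / R) * ((u (t *\<^sub>R y) - u y) * w1 y)" by (simp add: algebra_simps)
      also have "\<bar>\<dots>\<bar> = bump (norm y / R) * (\<bar>u (t *\<^sub>R y) - u y\<bar> * w1 y)"
        using bump_range by (simp add: abs_mult)
      also have "\<dots> \<le> 1 * (\<bar>t - 1\<bar> * (C * u y) * w1 y)"
        using lip[OF True t] bump_range by (intro mult_mono mult_right_mono) auto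
      finally show ?thesis by (simp add: e1_eq mult_ac)
    next
      case False
      then have "bump (norm y / R) = 0" using R by (intro bump_eq_0) simp
      then show ?thesis using C0 e1_nonneg[of y] by simp
    qed
    show "((\<lambda>t. bump (norm y / R) * (u (t *\<^sub>R y) * w1 y)) has_real_derivative
        bump (norm y / R) * (blinfun_apply (u' y) y * w1 y)) (at 1)" for y
    proof -
      have 1: "((\<lambda>t::real. t *\<^sub>R y) has_derivative (\<lambda>h. h *\<^sub>R y)) (at 1)"
        by (intro derivative_intros)
      have "((\<lambda>t. u (t *\<^sub>R y)) has_derivative (\<lambda>h. blinfun_apply (u' y) (h *\<^sub>R y))) (at 1)"
        using has_derivative_compose[OF 1, of u "blinfun_apply (u' y)"] u_deriv[of y] by simp
      then have "((\<lambda>t. u (t *\<^sub>R y)) has_real_derivative blinfun_apply (u' y) y) (at 1)"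
        by (simp add: has_field_derivative_def blinfun.scaleR_right mult_commute_abs)
      then show ?thesis by (intro DERIV_cmult DERIV_cmult_right)
    qed
  qed auto
  then show ?thesis by (rule that)
qed

section \<open>The commutator of the cutoff with the dilated kernel\<close>

definition dP :: "((real^'m) \<times> real) \<times> (real^'m) \<Rightarrow> real" where
  "dP z = deriv (\<lambda>t. P t z) 1"

lemma P_eq:
  "0 < snd (fst z) \<Longrightarrow> P t z = w2 (fst z) * w1 (snd z) * snd (fst z) powr lam *
    norm (fst z - (t *\<^sub>R snd z, 0)) powr - \<mu>"
  by (simp add: P_def poisson_kernel_eq)

lemma P_outside: "\<not> 0 < snd (fst z) \<Longrightarrow> P t z = 0"
  by (simp add: P_def v_outside)

lemma P_deriv: "((\<lambda>t. P t z) has_real_derivative dP z) (at 1)"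
proof -
  have "(\<lambda>t. P t z) differentiable at 1"
  proof (cases "0 < snd (fst z)")
    case True
    show ?thesis unfolding P_def
      by (intro derivative_intros differentiable_poisson_kernel_dilation True)
  qed (simp add: P_outside)
  then show ?thesis
    unfolding dP_def by (simp add: DERIV_deriv_iff_real_differentiable)
qed

text \<open>The error integrand made by replacing the cutoff at \<open>y\<close> with the cutoff at
  \<open>x / t\<close>.\<close>

definition cutP :: "real \<Rightarrow> real \<Rightarrow> ((real^'m) \<times> real) \<times> (real^'m) \<Rightarrow> real" where
  "cutP R t z = (bump (norm (snd z) / R) - bump (norm (fst z) / R / t)) * P t z"

definition dcutP :: "real \<Rightarrow> ((real^'m) \<times> real) \<times> (real^'m) \<Rightarrow> real" where
  "dcutP R z = (bump (norm (snd z) / R) - bump (norm (fst z) / R)) * dP z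
    - bump_rate (norm (fst z) / R) * P 1 z"

text \<open>Changing \<open>t\<close> moves the pole by \<open>\<bar>t - 1\<bar> * norm y\<close>;
  the decay of the cutoff difference near the pole absorbs both the factor \<open>norm y\<close> and
  the extra order of singularity. The constant is independent of \<open>R\<close>.\<close>

lemma cutP_bound:
  assumes R: "0 < R" and t: "t \<in> {1/2<..<2}"
  shows "\<bar>cutP R t z - cutP R 1 z\<bar> \<le> \<bar>t - 1\<bar> * (16 * (1 + \<mu>) * (P 1 z + P t z))"
proof (cases "0 < snd (fst z)")
  case True
  obtain x y where z: "z = (x, y)" by (cases z)
  have x: "0 < snd x" using True z by simp
  define \<rho> where "\<rho> s = norm (x - (s *\<^sub>R y, 0))" for s
  define c where "c = w2 x * w1 y * snd x powr lam"
  define h where "h s = bump (norm y / R) - bump (norm x / R / s)" for s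
  have c0: "0 \<le> c" by (simp add: c_def)
  have Pz: "P s z = c * \<rho> s powr - \<mu>" for s
    using P_eq[OF True, of s] by (simp add: z c_def \<rho>_def)
  have "\<bar>\<rho> t - \<rho> 1\<bar> \<le> norm ((x - (t *\<^sub>R y, 0)) - (x - (1 *\<^sub>R y, 0)))"
    unfolding \<rho>_def by (rule norm_triangle_ineq3)
  also have "(x - (t *\<^sub>R y, 0)) - (x - (1 *\<^sub>R y, 0)) = ((1 - t) *\<^sub>R y, 0::real)"
    by (cases x) (simp add: algebra_simps)
  also have "norm \<dots> = \<bar>t - 1\<bar> * norm y"
    by (simp add: norm_Pair abs_minus_commute)
  finally have 1: "\<bar>\<rho> t - \<rho> 1\<bar> \<le> \<bar>t - 1\<bar> * norm y" .
  have 2: "\<bar>h s\<bar> * norm y \<le> 16 * \<rho> s" if "s \<in> {1/2<..<2}" for s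
    unfolding h_def \<rho>_def by (rule cutoff_diff_bound[OF R that])
  have 3: "\<bar>h t - h 1\<bar> \<le> 16 * \<bar>t - 1\<bar>"
    using bump_dilation_bound[of "norm x / R" t] R t by (simp add: h_def abs_minus_commute)
  have pos: "0 < \<rho> s" for s
    unfolding \<rho>_def by (rule norm_dilation_pos[OF x])
  have "\<bar>h t * \<rho> t powr - \<mu> - h 1 * \<rho> 1 powr - \<mu>\<bar>
      \<le> \<bar>t - 1\<bar> * (16 * (1 + \<mu>) * (\<rho> 1 powr - \<mu> + \<rho> t powr - \<mu>))"
    \<comment> \<open>Applied with \<open>a = \<rho> 1\<close>, \<open>b = \<rho> t\<close>,
      \<open>l = norm y\<close>, \<open>d = \<bar>t - 1\<bar>\<close> and
      \<open>C = 16\<close>.\<close>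
    by (rule commutator_bound[OF pos pos mu 1 2 2 3]) (use t in auto)
  then have "c * \<bar>h t * \<rho> t powr - \<mu> - h 1 * \<rho> 1 powr - \<mu>\<bar>
      \<le> c * (\<bar>t - 1\<bar> * (16 * (1 + \<mu>) * (\<rho> 1 powr - \<mu> + \<rho> t powr - \<mu>)))"
    using c0 by (rule mult_left_mono)
  also have "c * \<bar>h t * \<rho> t powr - \<mu> - h 1 * \<rho> 1 powr - \<mu>\<bar>
      = \<bar>c * (h t * \<rho> t powr - \<mu> - h 1 * \<rho> 1 powr - \<mu>)\<bar>"
    using c0 by (simp add: abs_mult)
  also have "c * (h t * \<rho> t powr - \<mu> - h 1 * \<rho> 1 powr - \<mu>) = cutP R t z - cutP R 1 z"
    unfolding cutP_def Pz by (simp add: z h_def algebra_simps)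
  also have "c * (\<bar>t - 1\<bar> * (16 * (1 + \<mu>) * (\<rho> 1 powr - \<mu> + \<rho> t powr - \<mu>)))
      = \<bar>t - 1\<bar> * (16 * (1 + \<mu>) * (P 1 z + P t z))"
    unfolding Pz by (simp add: algebra_simps)
  finally show ?thesis .
qed (simp add: cutP_def P_outside)

lemma integrable_cutP: "0 < t \<Longrightarrow> integrable L (cutP R t)"
proof -
  assume t: "0 < t"
  have "integrable L (\<lambda>z. bump (norm (snd z) / R) * P t z)"
    using bump_range by (intro integral_P_snd_mult(1)[where C = 1 and a = "\<lambda>y. bump (norm y / R)"] t) auto
  moreover have "integrable L (\<lambda>z. bump (norm (fst z) / R / t) * P t z)"
    using bump_range by (intro integral_P_fst_mult(1)[where C = 1 and a = "\<lambda>x. bump (norm x / R / t)"] t) auto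
  ultimately show ?thesis
    unfolding cutP_def[abs_def] left_diff_distrib by (rule Bochner_Integration.integrable_diff)
qed

lemma
  assumes R: "0 < R"
  shows integrable_dcutP: "integrable L (dcutP R)"
    and dcutP_bound: "\<bar>dcutP R z\<bar> \<le> 32 * (1 + \<mu>) * P 1 z"
    and integral_cutP_deriv:
      "((\<lambda>t. integral\<^sup>L L (cutP R t)) has_real_derivative integral\<^sup>L L (dcutP R)) (at 1)"
proof -
  \<comment> \<open>At \<open>t = 1\<close> this is \<open>32 * (1 + \<mu>) * P 1 z\<close>, the
    bound inherited by the derivative and uniform in \<open>R\<close>.\<close>
  define G where "G t z = 16 * (1 + \<mu>) * (P 1 z + P t z)" for t z
  have G: "integrable L (G t)" if "0 < t" for t
    unfolding G_def using integrable_P[OF that] integrable_P[of 1] by auto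
  have IG: "integral\<^sup>L L (G t) = 16 * (1 + \<mu>) * (integral\<^sup>L L (P 1) + integral\<^sup>L L (P t))" if "0 < t" for t
    unfolding G_def using integrable_P[OF that] integrable_P[of 1] by simp
  have D: "((\<lambda>t. cutP R t z) has_real_derivative dcutP R z) (at 1)" for z
  proof -
    have "((\<lambda>t. bump (norm (snd z) / R) - bump (norm (fst z) / R / t)) has_real_derivative
        0 - bump_rate (norm (fst z) / R)) (at 1)"
      by (intro DERIV_diff DERIV_const has_real_derivative_bump_dilation)
    from DERIV_mult[OF this P_deriv[of z]] show ?thesis
      by (simp add: cutP_def dcutP_def algebra_simps)
  qed
  have limP: "((\<lambda>t. P t z) \<longlongrightarrow> P 1 z) (at 1)" for z
    using DERIV_isCont[OF P_deriv[of z]] by (simp add: isCont_def)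
  have limG: "((\<lambda>t. G t z) \<longlongrightarrow> G 1 z) (at 1)" for z
    unfolding G_def by (intro tendsto_intros limP)
  have "((\<lambda>t. 16 * (1 + \<mu>) * (integral\<^sup>L L (P 1) + integral\<^sup>L L (P t))) \<longlongrightarrow>
      16 * (1 + \<mu>) * (integral\<^sup>L L (P 1) + integral\<^sup>L L (P 1))) (at 1)"
    by (intro tendsto_intros tendsto_integral_P)
  moreover have "\<forall>\<^sub>F t::real in at 1. t \<in> {1/2<..<2}"
    by (rule eventually_at_in_open') auto
  then have "\<forall>\<^sub>F t in at 1. integral\<^sup>L L (G t) = 16 * (1 + \<mu>) * (integral\<^sup>L L (P 1) + integral\<^sup>L L (P t))"
    by eventually_elim (simp add: IG)
  ultimately have limIG: "((\<lambda>t. integral\<^sup>L L (G t)) \<longlongrightarrow> integral\<^sup>L L (G 1)) (at 1)"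
    by (simp add: IG tendsto_cong)
  have S: "open {1/2<..<2::real}" "1 \<in> {1/2<..<2::real}" by auto
  have F': "integrable L (cutP R t)" if "t \<in> {1/2<..<2}" for t
    using that by (intro integrable_cutP) auto
  have G': "integrable L (G t)" if "t \<in> {1/2<..<2}" for t
    using that by (intro G) auto
  have B: "\<bar>cutP R t z - cutP R 1 z\<bar> \<le> \<bar>t - 1\<bar> * G t z" if "t \<in> {1/2<..<2}" for t z
    unfolding G_def by (rule cutP_bound[OF R that])
  note main = has_real_derivative_integral[OF S F' G' B D limG limIG]
  show "integrable L (dcutP R)" by (rule main(1))
  show "((\<lambda>t. integral\<^sup>L L (cutP R t)) has_real_derivative integral\<^sup>L L (dcutP R)) (at 1)"
    by (rule main(2))
  have "\<bar>dcutP R z\<bar> \<le> G 1 z"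
    by (rule main(3)) (simp_all add: space_pair_measure)
  then show "\<bar>dcutP R z\<bar> \<le> 32 * (1 + \<mu>) * P 1 z"
    by (simp add: G_def algebra_simps)
qed

text \<open>The cut-off integral \<open>f\<close> lies below two explicit functions \<open>U\<close>
  and \<open>V\<close> and meets both at \<open>t = 1\<close>. Since \<open>f\<close> is
  differentiable there, the derivatives of \<open>U\<close> and \<open>V\<close> agree, and the two
  sides are these derivatives.\<close>

lemma cutoff_identity:
  assumes R: "0 < R"
  defines "J1 \<equiv> \<integral>y. bump (norm y / R) * e1 y \<partial>lborel"
    and "J2 \<equiv> \<integral>x. bump (norm x / R) * e2 x \<partial>lborel"
    and "K1 \<equiv> \<integral>y. bump_rate (norm y / R) * e1 y \<partial>lborel"
    and "K2 \<equiv> \<integral>x. bump_rate (norm x / R) * e2 x \<partial>lborel"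
  shows "(\<alpha> - CARD('m)) / (p + 1) * J1 + K1 / (p + 1) =
    (lam - \<mu>) * J2 + (CARD('m) + 1 - \<beta>) / (q + 1) * J2 + q / (q + 1) * K2 + integral\<^sup>L L (dcutP R)"
proof -
  let ?S = "{1/2<..<2::real}"
  define f where "f t = (\<integral>y. bump (norm y / R) * (u (t *\<^sub>R y) * w1 y) \<partial>lborel)" for t
  define A1 where "A1 t = (\<integral>y. bump (norm y / R / t) * e1 y \<partial>lborel)" for t
  define A2 where "A2 t = (\<integral>x. bump (norm x / R / t) * e2 x \<partial>lborel)" for t
  \<comment> \<open>The substitution in the term with \<open>u (t *\<^sub>R y)\<close> dilates the
    cutoff, hence \<open>A1 t\<close>; the other Young term keeps the fixed cutoff
    \<open>J1\<close>.\<close>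
  define U where "U t = t powr (\<alpha> - CARD('m)) / (p + 1) * A1 t + p / (p + 1) * J1" for t
  \<comment> \<open>The cutoff is now taken at \<open>x / t\<close>, so the substitution undoes its
    dilation in the term with \<open>v (x /\<^sub>R t)\<close>, which becomes \<open>J2\<close>, and
    the dilated cutoff \<open>A2 t\<close> stays with the other term.\<close>
  define V where "V t = t powr (lam - \<mu>) *
    (t powr (CARD('m) + 1 - \<beta>) / (q + 1) * J2 + q / (q + 1) * A2 t) + integral\<^sup>L L (cutP R t)" for t
  have A: "A1 1 = J1" "A2 1 = J2"
    by (simp_all add: A1_def A2_def J1_def J2_def)
  have b1: "integrable lborel (\<lambda>y. bump (norm y / R / t) * e1 y)" for t
    using bump_range by (intro integrable_bounded_mult[where C = 1] integrable_e1) auto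
  have b2: "integrable lborel (\<lambda>x. bump (norm x / R / t) * e2 x)" for t
    using bump_range by (intro integrable_bounded_mult[where C = 1] integrable_e2) auto
  have dA1: "(A1 has_real_derivative K1) (at 1)" unfolding A1_def K1_def
    by (rule has_real_derivative_integral_bump[OF integrable_e1 R])
  have dA2: "(A2 has_real_derivative K2) (at 1)" unfolding A2_def K2_def
    by (rule has_real_derivative_integral_bump[OF integrable_e2 R])
  have dpow: "((\<lambda>t. t powr s) has_real_derivative s) (at 1)" for s :: real
    using has_real_derivative_powr[of 1 s] by simp
  obtain D where dF: "(f has_real_derivative D) (at 1)"
    using cutoff_u_differentiable[OF R] unfolding f_def by blast
  have dU: "(U has_real_derivative ((\<alpha> - CARD('m)) / (p + 1) * J1 + K1 / (p + 1))) (at 1)"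
    unfolding U_def
    by (rule DERIV_cong, rule derivative_intros, rule DERIV_mult[OF DERIV_cdivide[OF dpow] dA1],
        rule DERIV_const) (simp add: A)
  have "((\<lambda>t. t powr (CARD('m) + 1 - \<beta>) / (q + 1) * J2 + q / (q + 1) * A2 t) has_real_derivative
      (CARD('m) + 1 - \<beta>) / (q + 1) * J2 + q / (q + 1) * K2) (at 1)"
    by (intro DERIV_add DERIV_cmult dA2 DERIV_cmult_right DERIV_cdivide dpow)
  from DERIV_add[OF DERIV_mult[OF dpow[of "lam - \<mu>"] this] integral_cutP_deriv[OF R]]
  have dV': "(V has_real_derivative (lam - \<mu>) * (1 / (q + 1) * J2 + q / (q + 1) * J2) +
      ((CARD('m) + 1 - \<beta>) / (q + 1) * J2 + q / (q + 1) * K2) + integral\<^sup>L L (dcutP R)) (at 1)"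
    unfolding V_def by (simp add: A)
  have "1 / (q + 1) + q / (q + 1) = 1"
    using q by (simp flip: add_divide_distrib)
  \<comment> \<open>The Young weights sum to 1, so differentiating the factor
    \<open>t powr (lam - \<mu>)\<close> contributes exactly
    \<open>(lam - \<mu>) * J2\<close>.\<close>
  then have J2': "1 / (q + 1) * J2 + q / (q + 1) * J2 = J2"
    unfolding distrib_right[symmetric] by simp
  have fU: "f t \<le> U t" if "t \<in> ?S" for t
  proof -
    have t: "0 < t" using that by auto
    define Y where "Y y = norm y powr - \<alpha> * u (t *\<^sub>R y) powr (p + 1)" for y
    have eq: "bump (norm (y /\<^sub>R t) / R) * e1 y = bump (norm y / R / t) * e1 y" for y :: "real^'m"
      using t by (simp add: field_simps)
    note d = integral_e1_dilate[of "\<lambda>y. bump (norm y / R)" t, unfolded eq, OF b1 t, folded Y_def]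
    have y: "(\<lambda>y. bump (norm y / R) * young1 t y) =
        (\<lambda>y. bump (norm y / R) * Y y / (p + 1) + p / (p + 1) * (bump (norm y / R) * e1 y))"
      by (simp add: fun_eq_iff young1_def Y_def distrib_left)
    have b1': "integrable lborel (\<lambda>y. bump (norm y / R) * e1 y)" using b1[of 1] by simp
    have "f t \<le> (\<integral>y. bump (norm y / R) * young1 t y \<partial>lborel)"
      unfolding f_def
    proof (rule integral_mono)
      show "integrable lborel (\<lambda>y. bump (norm y / R) * (u (t *\<^sub>R y) * w1 y))"
        using bump_range t by (intro integrable_bounded_mult[where C = 1] integrable_u_dilate) auto
      show "integrable lborel (\<lambda>y. bump (norm y / R) * young1 t y)"
        using bump_range t by (intro integrable_bounded_mult[where C = 1] integrable_young1) auto
    qed (intro mult_left_mono young1_ge bump_range)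
    also have "\<dots> = (\<integral>y. bump (norm y / R) * Y y / (p + 1) \<partial>lborel)
        + (\<integral>y. p / (p + 1) * (bump (norm y / R) * e1 y) \<partial>lborel)"
      unfolding y by (intro Bochner_Integration.integral_add integrable_divide integrable_mult_right d(1) b1')
    also have "\<dots> = U t"
      unfolding integral_divide_zero integral_mult_right_zero d(2) U_def A1_def J1_def by simp
    finally show ?thesis .
  qed
  \<comment> \<open>The double integral with the cutoff at \<open>y\<close> is rewritten with the
    cutoff at \<open>x / t\<close>, at the cost of \<open>cutP\<close>; Fubini then integrates out
    \<open>y\<close>.\<close>
  have split: "f t = (\<integral>x. bump (norm x / R / t) * (t powr (lam - \<mu>) * v (x /\<^sub>R t) * w2 x) \<partial>lborel)
      + integral\<^sup>L L (cutP R t)" if t: "0 < t" for t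
  proof -
    note s = integral_P_snd_mult[of "\<lambda>y. bump (norm y / R)" 1 t, OF _ _ t]
    note r = integral_P_fst_mult[of "\<lambda>x. bump (norm x / R / t)" 1 t, OF _ _ t]
    have a: "\<bar>bump x\<bar> \<le> 1" for x using bump_range by simp
    have "f t = (\<integral>z. bump (norm (snd z) / R) * P t z \<partial>L)"
      unfolding f_def using a by (subst s(2)) auto
    also have "\<dots> = (\<integral>z. bump (norm (fst z) / R / t) * P t z + cutP R t z \<partial>L)"
      by (simp add: cutP_def algebra_simps)
    also have "\<dots> = (\<integral>z. bump (norm (fst z) / R / t) * P t z \<partial>L) + integral\<^sup>L L (cutP R t)"
      using a by (intro Bochner_Integration.integral_add integrable_cutP t r(1)) auto
    also have "(\<integral>z. bump (norm (fst z) / R / t) * P t z \<partial>L) =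
        (\<integral>x. bump (norm x / R / t) * (t powr (lam - \<mu>) * v (x /\<^sub>R t) * w2 x) \<partial>lborel)"
      using a by (intro r(3)) auto
    finally show ?thesis .
  qed
  have fV: "f t \<le> V t" if "t \<in> ?S" for t
  proof -
    have t: "0 < t" using that by auto
    define Y where "Y x = norm x powr - \<beta> * v (x /\<^sub>R t) powr (q + 1)" for x
    have eq: "bump (norm (x /\<^sub>R t) / R) = bump (norm x / R / t)" for x :: "(real^'m) \<times> real"
      using t by (simp add: field_simps)
    have b2': "integrable lborel (\<lambda>x. bump (norm x / R) * e2 x)" using b2[of 1] by simp
    note d = integral_e2_dilate[of "\<lambda>x. bump (norm x / R)", OF b2' t, unfolded eq, folded Y_def]
    have y: "(\<lambda>x. bump (norm x / R / t) * (t powr (lam - \<mu>) * young2 t x)) =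
        (\<lambda>x. t powr (lam - \<mu>) * (bump (norm x / R / t) * Y x / (q + 1) + q / (q + 1) * (bump (norm x / R / t) * e2 x)))"
      by (simp add: fun_eq_iff young2_def Y_def distrib_left mult_ac)
    have iy: "integrable lborel (\<lambda>x. bump (norm x / R / t) * Y x / (q + 1))"
      "integrable lborel (\<lambda>x. q / (q + 1) * (bump (norm x / R / t) * e2 x))"
      by (intro integrable_divide integrable_mult_right d(1) b2)+
    have "(\<integral>x. bump (norm x / R / t) * (t powr (lam - \<mu>) * v (x /\<^sub>R t) * w2 x) \<partial>lborel)
        \<le> (\<integral>x. bump (norm x / R / t) * (t powr (lam - \<mu>) * young2 t x) \<partial>lborel)"
    proof (rule integral_mono)
      show "integrable lborel (\<lambda>x. bump (norm x / R / t) * (t powr (lam - \<mu>) * v (x /\<^sub>R t) * w2 x))"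
        using bump_range by (intro integral_P_fst_mult(2)[where C = 1] t) auto
      show "integrable lborel (\<lambda>x. bump (norm x / R / t) * (t powr (lam - \<mu>) * young2 t x))"
        unfolding y by (intro integrable_mult_right Bochner_Integration.integrable_add iy)
      show "bump (norm x / R / t) * (t powr (lam - \<mu>) * v (x /\<^sub>R t) * w2 x)
          \<le> bump (norm x / R / t) * (t powr (lam - \<mu>) * young2 t x)" for x
        unfolding mult.assoc[of "t powr _"] by (intro mult_left_mono young2_ge bump_range) simp
    qed
    also have "\<dots> = t powr (lam - \<mu>) * ((\<integral>x. bump (norm x / R / t) * Y x / (q + 1) \<partial>lborel)
        + (\<integral>x. q / (q + 1) * (bump (norm x / R / t) * e2 x) \<partial>lborel))"
      unfolding y integral_mult_right_zero[of _ "t powr _"] Bochner_Integration.integral_add[OF iy] ..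
    also have "\<dots> = t powr (lam - \<mu>) *
        (t powr (CARD('m) + 1 - \<beta>) / (q + 1) * J2 + q / (q + 1) * A2 t)"
      unfolding integral_divide_zero integral_mult_right_zero d(2) A2_def J2_def by simp
    finally show ?thesis unfolding split[OF t] V_def by simp
  qed
  have f1: "f 1 = J1"
    unfolding f_def J1_def by (simp add: e1_eq)
  have "1 / (p + 1) + p / (p + 1) = 1"
    using p by (simp flip: add_divide_distrib)
  then have "1 / (p + 1) * J1 + p / (p + 1) * J1 = J1"
    unfolding distrib_right[symmetric] by simp
  then have U1: "U 1 = J1"
    by (simp add: U_def A)
  have "f 1 = J2 + integral\<^sup>L L (cutP R 1)"
    unfolding split[OF zero_less_one] J2_def by (simp add: e2_eq)
  moreover have "V 1 = (1 / (q + 1) * J2 + q / (q + 1) * J2) + integral\<^sup>L L (cutP R 1)"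
    by (simp add: V_def A)
  ultimately have fV1: "f 1 = V 1" unfolding J2' by simp
  have S: "open ?S" "1 \<in> ?S" by auto
  have "D = (\<alpha> - CARD('m)) / (p + 1) * J1 + K1 / (p + 1)"
    by (rule has_real_derivative_unique_touching[OF dF dU _ S fU]) (simp_all add: f1 U1)
  moreover have "D = (lam - \<mu>) * (1 / (q + 1) * J2 + q / (q + 1) * J2) +
      ((CARD('m) + 1 - \<beta>) / (q + 1) * J2 + q / (q + 1) * K2) + integral\<^sup>L L (dcutP R)"
    by (rule has_real_derivative_unique_touching[OF dF dV' fV1 S fV])
  ultimately show ?thesis unfolding J2' by simp
qed

section \<open>Removal of the cutoff\<close>

lemma tendsto_integral_dcutP: "(\<lambda>k. integral\<^sup>L L (dcutP (real (Suc k)))) \<longlonglongrightarrow> 0"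
proof -
  have "(\<lambda>k. integral\<^sup>L L (dcutP (real (Suc k)))) \<longlonglongrightarrow> (\<integral>z. 0 \<partial>L)"
  proof (rule integral_dominated_convergence[where w = "\<lambda>z. 32 * (1 + \<mu>) * P 1 z"])
    show "dcutP (real (Suc k)) \<in> borel_measurable L" for k
      by (intro borel_measurable_integrable integrable_dcutP) simp
    show "integrable L (\<lambda>z. 32 * (1 + \<mu>) * P 1 z)" using integrable_P[of 1] by simp
    show "AE z in L. norm (dcutP (real (Suc k)) z) \<le> 32 * (1 + \<mu>) * P 1 z" for k
      using dcutP_bound[of "real (Suc k)"] by (intro AE_I2) (simp del: of_nat_Suc)
    \<comment> \<open>For fixed \<open>z\<close> both cutoffs tend to 1 and their rate to 0; taking
      \<open>Suc k\<close> as the radius keeps it positive.\<close>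
    have "(\<lambda>k. dcutP (real (Suc k)) z) \<longlonglongrightarrow> (1 - 1) * dP z - 0 * P 1 z" for z
      unfolding dcutP_def by (intro tendsto_intros tendsto_bump_dilate tendsto_bump_rate_dilate)
    then show "AE z in L. (\<lambda>k. dcutP (real (Suc k)) z) \<longlonglongrightarrow> 0" by simp
  qed simp
  then show ?thesis by simp
qed

lemma balance:
  "(CARD('m) - \<alpha>) / (p + 1) + (CARD('m) + 1 - \<beta>) / (q + 1) = \<mu> - lam"
proof -
  note t1 = tendsto_integral_cutoff[OF integrable_e1, folded E_def]
  note t2 = tendsto_integral_cutoff[OF integrable_e2, unfolded integral_e2]
  have "(\<lambda>k. (\<alpha> - CARD('m)) / (p + 1) * (\<integral>y. bump (norm y / real (Suc k)) * e1 y \<partial>lborel)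
      + (\<integral>y. bump_rate (norm y / real (Suc k)) * e1 y \<partial>lborel) / (p + 1))
    \<longlonglongrightarrow> (\<alpha> - CARD('m)) / (p + 1) * E + 0 / (p + 1)"
    using p by (intro tendsto_intros t1) auto
  moreover have "(\<lambda>k. (lam - \<mu>) * (\<integral>x. bump (norm x / real (Suc k)) * e2 x \<partial>lborel)
      + (CARD('m) + 1 - \<beta>) / (q + 1) * (\<integral>x. bump (norm x / real (Suc k)) * e2 x \<partial>lborel)
      + q / (q + 1) * (\<integral>x. bump_rate (norm x / real (Suc k)) * e2 x \<partial>lborel)
      + integral\<^sup>L L (dcutP (real (Suc k))))
    \<longlonglongrightarrow> (lam - \<mu>) * E + (CARD('m) + 1 - \<beta>) / (q + 1) * E + q / (q + 1) * 0 + 0"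
    by (intro tendsto_intros t2 tendsto_integral_dcutP)
  \<comment> \<open>The two sequences coincide by the cutoff identity. Both energies have the limit
    \<open>E\<close>, and the \<open>bump_rate\<close> and commutator terms disappear, so the common
    factor \<open>E > 0\<close> can be cancelled.\<close>
  ultimately have "(\<alpha> - CARD('m)) / (p + 1) * E = ((lam - \<mu>) + (CARD('m) + 1 - \<beta>) / (q + 1)) * E"
    using cutoff_identity[of "real (Suc _)"] LIMSEQ_unique
    by (simp add: distrib_right del: of_nat_Suc)
  then have "(\<alpha> - CARD('m)) / (p + 1) * E = ((lam - \<mu>) + (CARD('m) + 1 - \<beta>) / (q + 1)) * E" .
  then have "(\<alpha> - CARD('m)) / (p + 1) = (lam - \<mu>) + (CARD('m) + 1 - \<beta>) / (q + 1)"
    unfolding mult_cancel_right using E_pos by (metis less_irrefl)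
  moreover have "(\<alpha> - CARD('m)) / (p + 1) = - ((CARD('m) - \<alpha>) / (p + 1))"
    by (simp add: minus_divide_left)
  ultimately show ?thesis by linarith
qed

end

section \<open>Reduction of the theorem to the normalised system\<close>

theorem theorem1p7:
  fixes n :: nat
    and \<alpha> \<beta> lam \<mu> p\<^sub>0 q\<^sub>0 :: real
    and u :: "real^'m \<Rightarrow> real"
    and v :: "(real^'m) \<times> real \<Rightarrow> real"
  assumes "n = CARD('m) + 1" and "n \<ge> 3"
    and "lam \<ge> 0" and "\<alpha> \<ge> 0" and "\<beta> \<ge> 0"
    and "0 < p\<^sub>0" and "0 < q\<^sub>0"
    and "0 < \<mu>" and "\<mu> < real n - 2 * lam"
    and "C1_on UNIV u" and "C1_on half_space v"
    and "\<And>y. u y \<ge> 0" and "\<And>x. x \<in> half_space \<Longrightarrow> v x \<ge> 0"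
    and "\<exists>y. u y \<noteq> 0" and "\<exists>x\<in>half_space. v x \<noteq> 0"
    and "solves_system \<alpha> \<beta> lam \<mu> p\<^sub>0 q\<^sub>0 u v"
    and "u \<in> weighted_Lp (p\<^sub>0 + 1) (\<lambda>y. norm y powr (- \<alpha>)) UNIV"
    and "v \<in> weighted_Lp (q\<^sub>0 + 1) (\<lambda>x. norm x powr (- \<beta>)) half_space"
  shows "(real n - 1 - \<alpha>) / (p\<^sub>0 + 1) + (real n - \<beta>) / (q\<^sub>0 + 1) = \<mu> - lam"
proof -
  define V where "V x = (if x \<in> half_space then v x else 0)" for x
  have opn: "open (half_space :: ((real^'m) \<times> real) set)"
    unfolding half_space_def by (intro open_Collect_less continuous_intros)
  obtain u' where u': "\<And>y. (u has_derivative blinfun_apply (u' y)) (at y)" "continuous_on UNIV u'"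
    using \<open>C1_on UNIV u\<close> unfolding C1_on_def by auto
  have u_borel: "u \<in> borel_measurable borel"
    using u'(1) by (intro borel_measurable_continuous_onI)
      (meson continuous_at_imp_continuous_on has_derivative_continuous)
  have v_cont: "continuous_on half_space v"
    using \<open>C1_on half_space v\<close> unfolding C1_on_def
    by (meson continuous_at_imp_continuous_on has_derivative_continuous)
  have V_borel [measurable]: "V \<in> borel_measurable borel"
    unfolding V_def using opn v_cont by (intro borel_measurable_continuous_on_if) auto
  have V_nonneg: "0 \<le> V x" for x
    using assms(13) by (simp add: V_def)
  have u_eq: "ennreal (u y) =
      (\<integral>\<^sup>+x. ennreal (norm x powr - \<beta> * V x powr q\<^sub>0 * poisson_kernel lam x y \<mu>) \<partial>lborel)" for y
  proof -
    have "ennreal (u y) = (\<integral>\<^sup>+x\<in>half_space. ennreal (norm x powr (- \<beta>) * poisson_kernel lam x y \<mu> * v x powr q\<^sub>0) \<partial>lebesgue)"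
      using assms(16) unfolding solves_system_def by blast
    \<comment> \<open>Completion of the measure does not change the integral, and the indicator of
      the half space is absorbed by \<open>V\<close>, because \<open>0 powr\<close> anything is
      0.\<close>
    also have "\<dots> = (\<integral>\<^sup>+x. ennreal (norm x powr - \<beta> * V x powr q\<^sub>0 * poisson_kernel lam x y \<mu>) \<partial>lborel)"
      unfolding nn_integral_completion by (intro nn_integral_cong) (simp add: V_def mult_ac)
    finally show ?thesis .
  qed
  have v_eq: "ennreal (V x) =
      (\<integral>\<^sup>+y. ennreal (norm y powr - \<alpha> * u y powr p\<^sub>0 * poisson_kernel lam x y \<mu>) \<partial>lborel)"
    if "0 < snd x" for x
  proof -
    have x: "x \<in> half_space" using that by (simp add: half_space_def)
    then have "ennreal (V x) = (\<integral>\<^sup>+y. ennreal (norm y powr (- \<alpha>) * poisson_kernel lam x y \<mu> * u y powr p\<^sub>0) \<partial>lebesgue)"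
      using assms(16) unfolding solves_system_def V_def by simp
    also have "\<dots> = (\<integral>\<^sup>+y. ennreal (norm y powr - \<alpha> * u y powr p\<^sub>0 * poisson_kernel lam x y \<mu>) \<partial>lborel)"
      unfolding nn_integral_completion by (intro nn_integral_cong) (simp add: mult_ac)
    finally show ?thesis .
  qed
  have u_pos: "0 < u y" for y
  proof (rule ccontr)
    \<comment> \<open>A zero of \<open>u\<close> would force the non-negative integrand in its
      equation to vanish almost everywhere. It is positive on \<open>S\<close>, which is open by
      continuity and non-empty since \<open>v\<close> is non-trivial.\<close>
    define S where "S = {x \<in> half_space. v x \<in> - {0}}"
    have "open S"
      unfolding S_def by (rule continuous_open_preimage[OF v_cont opn, unfolded vimage_def Int_def mem_Collect_eq]) auto
    moreover have "S \<noteq> {}" using assms(15) by (auto simp: S_def)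
    ultimately have "\<not> (AE x in lborel. x \<notin> S)" by (rule not_AE_open)
    moreover assume "\<not> 0 < u y"
    then have "(\<integral>\<^sup>+x. ennreal (norm x powr - \<beta> * V x powr q\<^sub>0 * poisson_kernel lam x y \<mu>) \<partial>lborel) = 0"
      unfolding u_eq[symmetric] using assms(12)[of y] by (simp add: less_le)
    then have "AE x in lborel. ennreal (norm x powr - \<beta> * V x powr q\<^sub>0 * poisson_kernel lam x y \<mu>) = 0"
      by (subst (asm) nn_integral_0_iff_AE) simp_all
    then have "AE x in lborel. x \<notin> S"
    proof eventually_elim
      case (elim x)
      show ?case
      proof
        assume "x \<in> S"
        then have x: "0 < snd x" "0 < V x" "x \<noteq> 0"
          using V_nonneg[of x] by (auto simp: S_def V_def half_space_def less_le)
        then have "0 < poisson_kernel lam x y \<mu>"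
          using norm_dilation_pos[OF x(1)] by (simp add: poisson_kernel_eq)
        then have "0 < norm x powr - \<beta> * V x powr q\<^sub>0 * poisson_kernel lam x y \<mu>"
          using x by simp
        with elim show False by (simp add: ennreal_eq_0_iff)
      qed
    qed
    ultimately show False by blast
  qed
  have energy: "integrable lborel (\<lambda>y. norm y powr - \<alpha> * u y powr (p\<^sub>0 + 1))"
  proof (rule integrableI_bounded)
    show "(\<lambda>y. norm y powr - \<alpha> * u y powr (p\<^sub>0 + 1)) \<in> borel_measurable lborel"
      using u_borel by simp
    have "(\<integral>\<^sup>+y. ennreal (norm (norm y powr - \<alpha> * u y powr (p\<^sub>0 + 1))) \<partial>lborel)
        = (\<integral>\<^sup>+y\<in>UNIV. ennreal (\<bar>u y\<bar> powr (p\<^sub>0 + 1) * norm y powr - \<alpha>) \<partial>lebesgue)"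
      unfolding nn_integral_completion using assms(12)
      by (intro nn_integral_cong) (simp add: abs_mult mult_ac)
    also have "\<dots> < \<infinity>"
      using assms(17) by (simp add: weighted_Lp_def)
    finally show "(\<integral>\<^sup>+y. ennreal (norm (norm y powr - \<alpha> * u y powr (p\<^sub>0 + 1))) \<partial>lborel) < \<infinity>" .
  qed
  interpret kernel_system \<alpha> \<beta> lam \<mu> p\<^sub>0 q\<^sub>0 u u' V
    by unfold_locales
      (use assms(6-8) u' u_pos V_nonneg V_borel u_eq v_eq energy in \<open>auto simp: V_def half_space_def\<close>)
  show ?thesis using balance assms(1) by simp
qed

end
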